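(* Let $\alpha\in\mathbb{R}$ and let $\psi:\mathbb{N}\to(0,+\infty)$ be a monotonic function such that $$\sum_{n=1}^\infty\psi(n)\log n$$ diverges and such that for some $\varepsilon>0$, $$\liminf_{\ell\to\infty}\,q_\ell^{3-\varepsilon}\psi(q_\ell)\ge 1,$$ where $q_\ell=q_\ell(\alpha)$ denotes the denominators of the principal convergents of $\alpha$. Then for almost all $\beta\in\mathbb{R}$ (with respect to Lebesgue measure) there exist infinitely many $n\in\mathbb{N}$ such that $$\|n\alpha\|\,\|n\beta\|<\psi(n).$$
   Context: $\|x\|$ denotes the distance from $x\in\mathbb{R}$ to the nearest integer. For irrational $\alpha=[a_0;a_1,a_2,\dots]$ (simple continued fraction expansion), $q_\ell$ is the denominator of $[a_0;a_1,\dots,a_\ell]$ in lowest terms. If $\alpha$ is rational, there are only finitely many convergents and the $\liminf$ condition is regarded as vacuous. *)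

theory Defs
  imports "HOL-Analysis.Analysis"
begin

definition dist_nearest_int :: "real \<Rightarrow> real" where
  "dist_nearest_int x = \<bar>x - of_int (round x)\<bar>"

(* Complete quotients of x. For rational x the expansion stops once the fractional part
   is 0, and all later values are meaningless (1 / 0 = 0); the functions below are
   therefore only to be used for irrational x. *)
fun complete_quotient :: "real \<Rightarrow> nat \<Rightarrow> real" where
  "complete_quotient x 0 = x"
| "complete_quotient x (Suc k) = 1 / frac (complete_quotient x k)"

definition partial_quotient :: "real \<Rightarrow> nat \<Rightarrow> int" where
  "partial_quotient x k = \<lfloor>complete_quotient x k\<rfloor>"

(* The value of the finite continued fraction [a0; a1, ..., al]; the empty list is a
   dummy case. *)
fun cf_value :: "int list \<Rightarrow> rat" where
  "cf_value [] = 0"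
| "cf_value [a] = of_int a"
| "cf_value (a # b # as) = of_int a + 1 / cf_value (b # as)"

definition convergent_value :: "real \<Rightarrow> nat \<Rightarrow> rat" where
  "convergent_value x l = cf_value (map (partial_quotient x) [0..<Suc l])"

(* quotient_of yields the coprime representation with positive denominator, so nat does
   not truncate here. *)
definition convergent_denom :: "real \<Rightarrow> nat \<Rightarrow> nat" where
  "convergent_denom x l = nat (snd (quotient_of (convergent_value x l)))"

end

theory Submission
  imports Defs "HOL-Number_Theory.Totient" "HOL-Library.Discrete_Functions" "HOL-Real_Asymp.Real_Asymp"
begin

text \<open>
  Write \<open>\<parallel>x\<parallel>\<close> for the distance of \<open>x\<close> to the nearest integer and \<open>q\<^sub>l\<close> for the denominators of
  the convergents of \<open>\<alpha>\<close>. If \<open>\<alpha>\<close> is rational, all multiples of its denominator solve the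
  inequality. Otherwise \<open>\<parallel>q\<^sub>l \<alpha>\<parallel> \<le> 1 / q\<^sub>l\<^sub>+\<^sub>1\<close>. If \<open>\<parallel>q\<^sub>l \<alpha>\<parallel> < \<psi> q\<^sub>l\<close> for infinitely many \<open>l\<close>,
  then these \<open>q\<^sub>l\<close> solve it for every \<open>\<beta>\<close>; this covers every increasing \<open>\<psi>\<close>. If not, the lower
  bound on \<open>\<psi> q\<^sub>l\<close> turns into \<open>q\<^sub>l\<^sub>+\<^sub>1 \<le> 2 q\<^sub>l\<^sup>3\<close> for all large \<open>l\<close>. So each interval
  \<open>[2\<^sup>k\<^sup>/\<^sup>7, 2\<^sup>k\<^sup>/\<^sup>2]\<close> with \<open>k\<close> large contains the denominator of a reduced fraction \<open>p/q\<close> with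
  \<open>\<bar>\<alpha> - p/q\<bar> \<le> 1/q\<^sup>2\<close>.

  Such a fraction controls the rotation by \<open>\<alpha>\<close> on runs of \<open>q\<close> consecutive integers, where it is
  a small perturbation of a permutation of the multiples of \<open>1/q\<close>. Hence, for \<open>j \<le> k/14\<close>, the
  number of integers \<open>n\<close> in \<open>[2\<^sup>k, 2\<^sup>k\<^sup>+\<^sup>1)\<close> with \<open>\<parallel>n \<alpha>\<parallel> \<le> 2\<^sup>-\<^sup>j\<close> is at least of the order \<open>2\<^sup>k\<^sup>-\<^sup>j\<close>, and
  at most of the order \<open>2\<^sup>k\<^sup>-\<^sup>j / d\<close> if only multiples of a given small \<open>d\<close> are counted. On average over these \<open>n\<close> the sum of \<open>1/p\<close> over the primes
  dividing \<open>n\<close> is therefore bounded, so a positive proportion of them satisfies \<open>\<phi>(n) \<ge> c n\<close>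
  with \<open>c = exp (-98)\<close>: this is \<open>card_near_int_large_totient_ge\<close>. Summation over \<open>j\<close> gives
  \<open>\<Sum> 1/\<parallel>n \<alpha>\<parallel> \<ge> c' k 2\<^sup>k\<close> over these \<open>n\<close>, which explains the weight \<open>log n\<close> in the divergence
  condition.

  The problem is now one about \<open>\<beta>\<close> alone: \<open>\<parallel>n \<beta>\<parallel> < f n\<close> with \<open>f n\<close> essentially \<open>\<psi> n / \<parallel>n \<alpha>\<parallel>\<close>.
  Only approximations \<open>a/n\<close> in lowest terms are used. Then the sets \<open>A n\<close> of solutions \<open>\<beta>\<close>
  in the unit interval have measure \<open>2 f n \<phi>(n) / n\<close> and, distinct reduced fractions being well separated,
  their intersections have measure at most \<open>8 f m f n\<close>. The Chung-Erdos inequality shows that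
  the set of \<open>\<beta>\<close> lying in infinitely many \<open>A n\<close> has measure at least \<open>c\<^sub>0 = 2 c\<^sup>2 / 5\<close>
  (\<open>measure_limsup_reduced_nbhd_ge\<close>).

  The bound \<open>c\<^sub>0\<close> is the same for all \<open>\<psi>\<close>, so it also holds for \<open>\<psi> / C\<close> with every constant
  \<open>C\<close>, and hence for the set of those \<open>\<beta>\<close> that admit infinitely many solutions for every
  \<open>C\<close> simultaneously. Because \<open>\<parallel>n (2 \<beta>)\<parallel> \<le> 2 \<parallel>n \<beta>\<parallel>\<close>, that set is closed under doubling, and it has
  period one. A set of positive measure with these two properties has full measure
  (\<open>doubling_zero_one_law\<close>): a dyadic interval that it fills almost completely is blown up by
  doubling to an interval of length one.
\<close>

section \<open>The distance to the nearest integer\<close>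

lemma dist_nearest_int_le: "dist_nearest_int x \<le> \<bar>x - of_int m\<bar>"
  unfolding dist_nearest_int_def by (rule round_diff_minimal)

lemma dist_nearest_int_le_iff: "dist_nearest_int x \<le> y \<longleftrightarrow> (\<exists>m. \<bar>x - of_int m\<bar> \<le> y)"
  using dist_nearest_int_le[of x] order_trans unfolding dist_nearest_int_def by blast

lemma dist_nearest_int_nonneg: "dist_nearest_int x \<ge> 0"
  by (simp add: dist_nearest_int_def)

lemma dist_nearest_int_le_half: "dist_nearest_int x \<le> 1/2"
  using of_int_round_abs_le[of x] by (simp add: dist_nearest_int_def abs_minus_commute)

lemma dist_nearest_int_triangle: "dist_nearest_int x \<le> dist_nearest_int y + \<bar>x - y\<bar>"
  using dist_nearest_int_le[of x "round y"] by (simp add: dist_nearest_int_def)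

lemma borel_measurable_dist_nearest_int [measurable]: "dist_nearest_int \<in> borel_measurable borel"
  unfolding dist_nearest_int_def[abs_def] round_def by measurable

text \<open>This inequality makes the final limsup set, with all constants allowed, closed under doubling.\<close>
lemma dist_nearest_int_double: "dist_nearest_int (real n * (2 * x)) \<le> 2 * dist_nearest_int (real n * x)"
proof -
  have "dist_nearest_int (real n * (2 * x)) \<le> \<bar>real n * (2 * x) - of_int (2 * round (real n * x))\<bar>"
    by (rule dist_nearest_int_le)
  also have "real n * (2 * x) - of_int (2 * round (real n * x)) = 2 * (real n * x - of_int (round (real n * x)))"
    by simp
  finally have "dist_nearest_int (real n * (2 * x)) \<le> \<bar>2\<bar> * \<bar>real n * x - of_int (round (real n * x))\<bar>"
    by (simp only: abs_mult)
  thus ?thesis by (simp add: dist_nearest_int_def)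
qed

lemma dist_nearest_int_shift: "dist_nearest_int (real n * (x + 1)) = dist_nearest_int (real n * x)"
proof -
  have "round (real n * x + of_int (int n)) = round (real n * x) + int n"
    unfolding round_def by (metis add.commute add.left_commute floor_add_int)
  thus ?thesis by (simp add: dist_nearest_int_def algebra_simps)
qed

section \<open>Denominators of convergents\<close>

text \<open>Numerator and denominator of a continued fraction, computed from the front:
  \<open>a + 1 / (P/Q) = (a P + Q) / P\<close>. The empty list stands for the infinite value \<open>1/0\<close>, which makes
  the recursion uniform. Peeling off the first partial quotient replaces \<open>x\<close> by
  \<open>1 / frac x\<close>, so the facts below about convergents are inductions over all irrational \<open>x\<close>
  at once.\<close>
fun cf_num_denom :: "int list \<Rightarrow> int \<times> int" where
  "cf_num_denom [] = (1, 0)"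
| "cf_num_denom (a # as) = (a * fst (cf_num_denom as) + snd (cf_num_denom as), fst (cf_num_denom as))"

lemma coprime_cf_num_denom: "coprime (fst (cf_num_denom as)) (snd (cf_num_denom as))"
proof (induction as)
  case (Cons a as)
  then show ?case
    using gcd_add_mult[of "fst (cf_num_denom as)" a "snd (cf_num_denom as)"]
    by (simp add: coprime_iff_gcd_eq_1 gcd.commute)
qed simp

text \<open>The numerator grows at least linearly with the length when the leading entry is positive; since the
  denominator for \<open>x\<close> is the numerator for \<open>1 / frac x\<close>, this makes the denominators unbounded.\<close>
lemma cf_num_denom_pos:
  assumes "as \<noteq> []" and "\<forall>a\<in>set (tl as). a \<ge> 1"
  shows "snd (cf_num_denom as) \<ge> 1 \<and> (hd as \<ge> 1 \<longrightarrow> fst (cf_num_denom as) \<ge> int (length as))"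
  using assms
proof (induction as)
  case (Cons a as)
  show ?case
  proof (cases "as = []")
    case False
    have hd: "hd as \<ge> 1" using Cons.prems(2) False by simp
    have tl: "\<forall>a\<in>set (tl as). a \<ge> 1" using Cons.prems(2) False by (auto dest: list.set_sel(2))
    define P Q where "P = fst (cf_num_denom as)" and "Q = snd (cf_num_denom as)"
    have PQ: "Q \<ge> 1" "P \<ge> int (length as)"
      using Cons.IH[OF False tl] hd by (auto simp: P_def Q_def)
    have "length as \<ge> 1" using False by (cases as) auto
    hence P1: "P \<ge> 1" using PQ(2) by linarith
    have "a * P + Q \<ge> 1 + int (length as)" if "a \<ge> 1"
    proof -
      have "1 * P \<le> a * P" using that P1 by (intro mult_right_mono) auto
      thus ?thesis using PQ by linarith
    qed
    thus ?thesis using PQ P1 by (auto simp: P_def Q_def)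
  qed auto
qed simp

lemma cf_value_conv_num_denom:
  assumes "as \<noteq> []" and "\<forall>a\<in>set (tl as). a \<ge> 1"
  shows "cf_value as = of_int (fst (cf_num_denom as)) / of_int (snd (cf_num_denom as))"
  using assms
proof (induction as rule: cf_value.induct)
  case (3 a b as)
  have pos: "snd (cf_num_denom (b # as)) \<ge> 1" "fst (cf_num_denom (b # as)) \<ge> 1"
    using cf_num_denom_pos[of "b # as"] 3(3) by auto
  have "cf_value (a # b # as) = of_int a + 1 / cf_value (b # as)" by simp
  also have "cf_value (b # as)
      = of_int (fst (cf_num_denom (b # as))) / of_int (snd (cf_num_denom (b # as)))"
    using 3 by simp
  also have "of_int a + 1 / \<dots> = of_int (fst (cf_num_denom (a # b # as))) / of_int (snd (cf_num_denom (a # b # as)))"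
    using pos unfolding cf_num_denom.simps(2)[of a "b # as"]
    by (simp add: divide_simps del: cf_num_denom.simps)
  finally show ?case .
qed auto

text \<open>The pair is coprime with positive denominator, so it is the normal form of the rational number.\<close>
lemma quotient_of_cf_value:
  assumes "as \<noteq> []" and "\<forall>a\<in>set (tl as). a \<ge> 1"
  shows "quotient_of (cf_value as) = cf_num_denom as"
proof -
  define P Q where "P = fst (cf_num_denom as)" and "Q = snd (cf_num_denom as)"
  have Q: "Q \<ge> 1" using cf_num_denom_pos[OF assms] by (simp add: Q_def)
  have "cf_value as = Fract P Q"
    using cf_value_conv_num_denom[OF assms] by (simp add: P_def Q_def Fract_of_int_quotient)
  moreover have "coprime P Q" using coprime_cf_num_denom[of as] by (simp add: P_def Q_def)
  ultimately have "quotient_of (cf_value as) = (P, Q)"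
    using Q by (simp add: quotient_of_Fract normalize_stable)
  thus ?thesis by (simp add: P_def Q_def)
qed

lemma complete_quotient_shift:
  "complete_quotient x (Suc k) = complete_quotient (1 / frac x) k"
  by (induction k) auto

lemma partial_quotients_Suc:
  "map (partial_quotient x) [0..<Suc n] = \<lfloor>x\<rfloor> # map (partial_quotient (1 / frac x)) [0..<n]"
proof -
  have "[0..<Suc n] = 0 # map Suc [0..<n]" by (simp add: upt_conv_Cons map_Suc_upt del: upt_Suc)
  thus ?thesis
    by (simp add: partial_quotient_def complete_quotient_shift o_def del: upt_Suc complete_quotient.simps(2))
qed

lemma inverse_frac_irrational:
  assumes "x \<notin> \<rat>" shows "1 / frac x \<notin> \<rat>" "1 / frac x > 1"
proof -
  have *: "frac x \<notin> \<rat>"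
  proof
    assume "frac x \<in> \<rat>"
    hence "frac x + of_int \<lfloor>x\<rfloor> \<in> \<rat>" by (intro Rats_add) auto
    thus False using assms by (simp add: frac_def)
  qed
  thus "1 / frac x \<notin> \<rat>" using Rats_inverse[of "1 / frac x"] by (auto simp: divide_inverse)
  have "frac x \<noteq> 0" using * Rats_0 by metis
  hence "frac x > 0" using frac_ge_0[of x] by linarith
  thus "1 / frac x > 1" using frac_lt_1[of x] by simp
qed

lemma complete_quotient_irrational:
  assumes "x \<notin> \<rat>" shows "complete_quotient x k \<notin> \<rat>"
  using assms by (induction k) (use inverse_frac_irrational in auto)

lemma partial_quotient_ge_1:
  assumes "x \<notin> \<rat>" shows "partial_quotient x (Suc k) \<ge> 1"
  using inverse_frac_irrational(2)[OF complete_quotient_irrational[OF assms, of k]]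
  by (simp add: partial_quotient_def le_floor_iff)

definition convergent_num :: "real \<Rightarrow> nat \<Rightarrow> int" where
  "convergent_num x l = fst (cf_num_denom (map (partial_quotient x) [0..<Suc l]))"

lemma partial_quotients_tl_ge_1:
  assumes "x \<notin> \<rat>"
  shows "\<forall>a\<in>set (tl (map (partial_quotient x) [0..<Suc l])). a \<ge> 1"
proof -
  have "tl (map (partial_quotient x) [0..<Suc l]) = map (\<lambda>k. partial_quotient x (Suc k)) [0..<l]"
    by (simp add: upt_conv_Cons map_Suc_upt[symmetric] o_def del: upt_Suc)
  thus ?thesis using partial_quotient_ge_1[OF assms] by auto
qed

lemma convergent_denom_conv:
  assumes "x \<notin> \<rat>"
  shows "int (convergent_denom x l) = snd (cf_num_denom (map (partial_quotient x) [0..<Suc l]))"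
    and "convergent_denom x l \<ge> 1"
proof -
  have q: "quotient_of (convergent_value x l) = cf_num_denom (map (partial_quotient x) [0..<Suc l])"
    unfolding convergent_value_def
    by (rule quotient_of_cf_value[OF _ partial_quotients_tl_ge_1[OF assms]]) simp
  have "snd (cf_num_denom (map (partial_quotient x) [0..<Suc l])) \<ge> 1"
    using cf_num_denom_pos[OF _ partial_quotients_tl_ge_1[OF assms], of l] by simp
  thus "int (convergent_denom x l) = snd (cf_num_denom (map (partial_quotient x) [0..<Suc l]))"
    and "convergent_denom x l \<ge> 1"
    using q by (simp_all add: convergent_denom_def del: upt_Suc)
qed

lemma coprime_convergent:
  assumes "x \<notin> \<rat>" shows "coprime (convergent_num x l) (int (convergent_denom x l))"
  unfolding convergent_denom_conv[OF assms] convergent_num_def by (rule coprime_cf_num_denom)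

lemma convergent_recursion:
  assumes "x \<notin> \<rat>"
  shows "convergent_num x 0 = \<lfloor>x\<rfloor>" "convergent_denom x 0 = 1"
    and "convergent_num x (Suc l)
      = \<lfloor>x\<rfloor> * convergent_num (1 / frac x) l + int (convergent_denom (1 / frac x) l)"
    and "int (convergent_denom x (Suc l)) = convergent_num (1 / frac x) l"
proof -
  note y = inverse_frac_irrational[OF assms]
  show "convergent_num x 0 = \<lfloor>x\<rfloor>"
    by (simp add: convergent_num_def partial_quotient_def)
  show "convergent_denom x 0 = 1"
    using convergent_denom_conv(1)[OF assms, of 0] by simp
  show "convergent_num x (Suc l)
      = \<lfloor>x\<rfloor> * convergent_num (1 / frac x) l + int (convergent_denom (1 / frac x) l)"
    unfolding convergent_num_def convergent_denom_conv(1)[OF y(1)]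
    by (subst partial_quotients_Suc) simp
  show "int (convergent_denom x (Suc l)) = convergent_num (1 / frac x) l"
    unfolding convergent_num_def convergent_denom_conv(1)[OF assms]
    by (subst partial_quotients_Suc) simp
qed

text \<open>Convergents lie alternately below and above \<open>x\<close>: the error for \<open>x = \<lfloor>x\<rfloor> + 1/y\<close> is the error of the
  previous convergent of \<open>y\<close> divided by \<open>- y\<close>.\<close>
lemma convergent_error_sign:
  assumes "x \<notin> \<rat>"
  shows "(-1) ^ l * (real (convergent_denom x l) * x - of_int (convergent_num x l)) \<ge> 0"
  using assms
proof (induction l arbitrary: x)
  case 0
  then show ?case by (simp add: convergent_recursion)
next
  case (Suc l)
  define y where "y = 1 / frac x"
  note yy = inverse_frac_irrational[OF Suc.prems, folded y_def]
  have x: "x = of_int \<lfloor>x\<rfloor> + 1 / y" by (simp add: y_def frac_def)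
  have d: "real (convergent_denom x (Suc l)) = of_int (convergent_num y l)"
    using arg_cong[OF convergent_recursion(4)[OF Suc.prems, of l], of real_of_int] by (simp add: y_def)
  have n: "real_of_int (convergent_num x (Suc l)) = of_int \<lfloor>x\<rfloor> * of_int (convergent_num y l) + real (convergent_denom y l)"
    using convergent_recursion(3)[OF Suc.prems, of l] by (simp add: y_def)
  have "(-1) ^ Suc l * (real (convergent_denom x (Suc l)) * x - of_int (convergent_num x (Suc l)))
     = (-1) ^ Suc l * (of_int (convergent_num y l) * (x - of_int \<lfloor>x\<rfloor>) - real (convergent_denom y l))"
    unfolding d n by (simp add: algebra_simps)
  also have "x - of_int \<lfloor>x\<rfloor> = 1 / y" using x by linarith
  also have "(-1) ^ Suc l * (of_int (convergent_num y l) * (1 / y) - real (convergent_denom y l))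
     = ((-1) ^ l * (real (convergent_denom y l) * y - of_int (convergent_num y l))) / y"
    using yy(2) by (simp add: field_simps)
  finally show ?case using Suc.IH[OF yy(1)] yy(2) by simp
qed

lemma convergent_determinant:
  assumes "x \<notin> \<rat>"
  shows "int (convergent_denom x l) * convergent_num x (Suc l)
       - int (convergent_denom x (Suc l)) * convergent_num x l = (-1) ^ l"
  using assms
proof (induction l arbitrary: x)
  case 0
  then show ?case using inverse_frac_irrational[of x] by (simp add: convergent_recursion)
next
  case (Suc l)
  note y = inverse_frac_irrational[OF Suc.prems]
  show ?case
    using Suc.IH[OF y(1)]
    unfolding convergent_recursion(3,4)[OF Suc.prems] by (simp add: algebra_simps)
qed

text \<open>Eliminating \<open>x\<close> from the errors of two consecutive convergents leaves the determinant, so that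
  \<open>q\<^sub>l\<^sub>+\<^sub>1 e\<^sub>l - q\<^sub>l e\<^sub>l\<^sub>+\<^sub>1 = \<plusminus>1\<close>; as \<open>e\<^sub>l\<close> and \<open>e\<^sub>l\<^sub>+\<^sub>1\<close> have opposite signs, both terms on the
  left have the same sign and each is at most one in absolute value.\<close>
lemma convergent_error_bound:
  assumes "x \<notin> \<rat>"
  shows "\<bar>real (convergent_denom x l) * x - of_int (convergent_num x l)\<bar>
       * real (convergent_denom x (Suc l)) \<le> 1"
proof -
  define e where "e l = real (convergent_denom x l) * x - of_int (convergent_num x l)" for l
  have "real_of_int (int (convergent_denom x l) * convergent_num x (Suc l)
       - int (convergent_denom x (Suc l)) * convergent_num x l) = (-1) ^ l"
    unfolding convergent_determinant[OF assms] by simp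
  hence "real (convergent_denom x (Suc l)) * e l - real (convergent_denom x l) * e (Suc l) = (-1) ^ l"
    by (simp add: e_def algebra_simps)
  hence "(-1) ^ l * (real (convergent_denom x (Suc l)) * e l - real (convergent_denom x l) * e (Suc l)) = 1"
    by (simp flip: power_mult_distrib)
  hence sum: "real (convergent_denom x (Suc l)) * ((-1) ^ l * e l)
      + real (convergent_denom x l) * ((-1) ^ Suc l * e (Suc l)) = 1"
    by (simp add: algebra_simps)
  have s: "(-1) ^ l * e l \<ge> 0" "(-1) ^ Suc l * e (Suc l) \<ge> 0"
    using convergent_error_sign[OF assms] unfolding e_def by blast+
  have "\<bar>e l\<bar> = \<bar>(-1) ^ l * e l\<bar>" by (simp add: abs_mult)
  also have "\<dots> = (-1) ^ l * e l" using s(1) by (rule abs_of_nonneg)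
  finally have "\<bar>e l\<bar> * real (convergent_denom x (Suc l)) \<le> 1"
    using sum mult_nonneg_nonneg[OF _ s(2), of "real (convergent_denom x l)"] by (simp add: mult.commute)
  thus ?thesis by (simp add: e_def)
qed

lemma convergent_denom_ge:
  assumes "x \<notin> \<rat>" shows "convergent_denom x l \<ge> l"
proof (cases l)
  case (Suc m)
  define y where "y = 1 / frac x"
  note y = inverse_frac_irrational[OF assms, folded y_def]
  have "hd (map (partial_quotient y) [0..<Suc m]) \<ge> 1"
    using y(2) unfolding partial_quotients_Suc by (simp add: le_floor_iff)
  hence "convergent_num y m \<ge> int (Suc m)"
    using cf_num_denom_pos[OF _ partial_quotients_tl_ge_1[OF y(1)], of m]
    unfolding convergent_num_def by (simp del: upt_Suc)
  thus ?thesis using convergent_recursion(4)[OF assms, of m] Suc by (simp add: y_def)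
qed simp

lemma dist_nearest_int_convergent_denom:
  assumes "\<alpha> \<notin> \<rat>"
  shows "dist_nearest_int (real (convergent_denom \<alpha> l) * \<alpha>) * real (convergent_denom \<alpha> (Suc l)) \<le> 1"
proof -
  have "dist_nearest_int (real (convergent_denom \<alpha> l) * \<alpha>) * real (convergent_denom \<alpha> (Suc l))
     \<le> \<bar>real (convergent_denom \<alpha> l) * \<alpha> - of_int (convergent_num \<alpha> l)\<bar> * real (convergent_denom \<alpha> (Suc l))"
    by (intro mult_right_mono dist_nearest_int_le) auto
  also note convergent_error_bound[OF assms]
  finally show ?thesis .
qed

section \<open>Rotations close to a rational rotation\<close>

lemma card_int_interval:
  fixes a b :: real
  shows "finite {u::int. a \<le> of_int u \<and> of_int u \<le> b}"
    and "a \<le> b \<Longrightarrow> real (card {u::int. a \<le> of_int u \<and> of_int u \<le> b}) \<le> b - a + 1"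
    and "real (card {u::int. a \<le> of_int u \<and> of_int u \<le> b}) \<ge> b - a - 1"
proof -
  have eq: "{u::int. a \<le> of_int u \<and> of_int u \<le> b} = {\<lceil>a\<rceil>..\<lfloor>b\<rfloor>}"
    by (auto simp: ceiling_le_iff le_floor_iff)
  show "finite {u::int. a \<le> of_int u \<and> of_int u \<le> b}" by (simp add: eq)
  show "a \<le> b \<Longrightarrow> real (card {u::int. a \<le> of_int u \<and> of_int u \<le> b}) \<le> b - a + 1"
    unfolding eq by simp linarith
  show "real (card {u::int. a \<le> of_int u \<and> of_int u \<le> b}) \<ge> b - a - 1"
    unfolding eq by simp linarith
qed

text \<open>Multiplication by \<open>p\<close> permutes the residues modulo \<open>q\<close>, so the points \<open>c + i p/q\<close> with \<open>i < q\<close> are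
  modulo one a translate of all multiples of \<open>1/q\<close>. The indices \<open>i\<close> that count correspond to the
  integers \<open>u\<close> (congruent to \<open>i p\<close>) in the interval of length \<open>2 y q\<close> around \<open>- c q\<close>; if
  \<open>2 y < 1\<close>, no residue occurs twice there.\<close>
lemma card_rational_rotation:
  fixes p :: int and q :: nat and c y :: real
  assumes "q > 0" and cop: "coprime p (int q)"
  defines "S \<equiv> {i. i < q \<and> dist_nearest_int (c + real i * (of_int p / real q)) \<le> y}"
  shows "y \<ge> 0 \<Longrightarrow> real (card S) \<le> 2 * y * real q + 1"
    and "2 * y < 1 \<Longrightarrow> real (card S) \<ge> 2 * y * real q - 1"
proof -
  define U where "U = {u::int. - c * real q - y * real q \<le> of_int u \<and> of_int u \<le> - c * real q + y * real q}"
  note U = card_int_interval[where a = "- c * real q - y * real q" and b = "- c * real q + y * real q", folded U_def]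
  have memU: "u \<in> U \<longleftrightarrow> \<bar>of_int u + c * real q\<bar> \<le> y * real q" for u
    unfolding U_def abs_le_iff by auto
  have finS: "finite S" by (simp add: S_def)
  have key: "\<bar>c + real i * (of_int p / real q) - of_int s\<bar> \<le> y \<longleftrightarrow> int i * p - s * int q \<in> U" for i s
  proof -
    have "\<bar>c + real i * (of_int p / real q) - of_int s\<bar> * real q
        = \<bar>(c + real i * (of_int p / real q) - of_int s) * real q\<bar>"
      by (simp add: abs_mult)
    also have "(c + real i * (of_int p / real q) - of_int s) * real q
        = of_int (int i * p - s * int q) + c * real q"
      using \<open>q > 0\<close> by (simp add: field_simps)
    finally show ?thesis using \<open>q > 0\<close> unfolding memU
      by (metis mult_le_cancel_right_pos of_nat_0_less_iff)
  qed
  {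
    assume y: "y \<ge> 0"
    define h where "h i = int i * p - round (c + real i * (of_int p / real q)) * int q" for i
    have "inj_on h S"
    proof
      fix i j assume ij: "i \<in> S" "j \<in> S" "h i = h j"
      have "[int i * p = h i] (mod int q)" "[int j * p = h j] (mod int q)"
        by (simp_all add: h_def cong_iff_dvd_diff)
      hence "[int i * p = int j * p] (mod int q)" using ij(3) by (metis cong_sym cong_trans)
      hence "[int i = int j] (mod int q)" using cop by (simp add: cong_mult_rcancel coprime_commute)
      thus "i = j" using ij(1,2) by (simp add: S_def cong_def flip: of_nat_mod)
    qed
    moreover have "h ` S \<subseteq> U"
      using key by (auto simp: h_def S_def dist_nearest_int_def)
    ultimately have "card S \<le> card U" using U(1) by (metis card_inj_on_le)
    moreover have "real (card U) \<le> 2 * y * real q + 1" using U(2) y by simp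
    ultimately show "real (card S) \<le> 2 * y * real q + 1" by linarith
  }
  {
    assume y: "2 * y < 1"
    obtain r where r: "[p * r = 1] (mod int q)" using cong_solve_coprime_int[OF cop] by blast
    define g where "g u = nat ((u * r) mod int q)" for u
    have g: "int (g u) = (u * r) mod int q" for u using \<open>q > 0\<close> by (simp add: g_def)
    have gp: "[int (g u) * p = u] (mod int q)" for u
    proof -
      have "[int (g u) * p = u * r * p] (mod int q)" unfolding g by (simp add: cong_def mod_mult_left_eq)
      also have "u * r * p = u * (p * r)" by simp
      also have "[u * (p * r) = u * 1] (mod int q)" by (rule cong_scalar_left[OF r])
      finally show ?thesis by simp
    qed
    have "inj_on g U"
    proof
      fix u v assume uv: "u \<in> U" "v \<in> U" "g u = g v"
      have "[u = v] (mod int q)" using gp[of u] gp[of v] uv(3) by (metis cong_sym cong_trans)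
      hence d: "int q dvd u - v" by (simp add: cong_iff_dvd_diff)
      have "\<bar>real_of_int (u - v)\<bar> \<le> 2 * y * real q" using uv(1,2) unfolding memU by simp
      also have "\<dots> < real q" using y \<open>q > 0\<close> by simp
      finally have "\<bar>u - v\<bar> < int q" by linarith
      thus "u = v" using d zdvd_imp_le[of "int q" "\<bar>u - v\<bar>"] by fastforce
    qed
    moreover have "g ` U \<subseteq> S"
    proof
      fix i assume "i \<in> g ` U"
      then obtain u where u: "u \<in> U" "i = g u" by blast
      obtain s where s: "int (g u) * p - u = int q * s" using gp[of u] by (auto simp: cong_iff_dvd_diff)
      hence "int i * p - s * int q = u" using u by (simp add: algebra_simps)
      hence "\<bar>c + real i * (of_int p / real q) - of_int s\<bar> \<le> y" using key u by simp
      moreover have "int i < int q" using g[of u] u(2) \<open>q > 0\<close> by simp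
      ultimately show "i \<in> S" unfolding S_def by (auto simp: dist_nearest_int_le_iff)
    qed
    ultimately have "card U \<le> card S" using finS by (metis card_inj_on_le)
    thus "real (card S) \<ge> 2 * y * real q - 1" using U(3) by linarith
  }
qed

text \<open>Within a run of length \<open>q\<close> the rotation by \<open>\<gamma>\<close> deviates from the rotation by \<open>p/q\<close> by at most
  \<open>\<eta>\<close>, which only changes the radius.\<close>
lemma card_rotation_run:
  fixes p :: int and q :: nat and c x \<gamma> \<eta> :: real
  assumes "q > 0" and cop: "coprime p (int q)"
    and \<eta>: "\<bar>\<gamma> - of_int p / real q\<bar> * real q \<le> \<eta>"
  defines "S \<equiv> {i. i < q \<and> dist_nearest_int (c + real i * \<gamma>) \<le> x}"
  shows "x \<ge> 0 \<Longrightarrow> real (card S) \<le> 2 * (x + \<eta>) * real q + 1"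
    and "2 * (x - \<eta>) < 1 \<Longrightarrow> real (card S) \<ge> 2 * (x - \<eta>) * real q - 1"
proof -
  define S' where "S' y = {i. i < q \<and> dist_nearest_int (c + real i * (of_int p / real q)) \<le> y}" for y
  have near: "\<bar>(c + real i * \<gamma>) - (c + real i * (of_int p / real q))\<bar> \<le> \<eta>" if "i < q" for i
  proof -
    have "\<bar>(c + real i * \<gamma>) - (c + real i * (of_int p / real q))\<bar> = real i * \<bar>\<gamma> - of_int p / real q\<bar>"
      by (simp add: abs_mult del: times_divide_eq_right flip: right_diff_distrib)
    also have "\<dots> \<le> real q * \<bar>\<gamma> - of_int p / real q\<bar>" using that by (intro mult_right_mono) auto
    also have "\<dots> \<le> \<eta>" using \<eta> by (simp add: mult.commute)
    finally show ?thesis .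
  qed
  have \<eta>0: "\<eta> \<ge> 0" using near[OF \<open>q > 0\<close>] by linarith
  have "S \<subseteq> S' (x + \<eta>)"
    using dist_nearest_int_triangle near unfolding S_def S'_def
    by (smt (verit, best) mem_Collect_eq subsetI)
  moreover have "S' (x - \<eta>) \<subseteq> S"
    using dist_nearest_int_triangle near unfolding S_def S'_def
    by (smt (verit, best) mem_Collect_eq subsetI)
  moreover have "finite S" "finite (S' y)" for y by (auto simp: S_def S'_def)
  ultimately have card: "card S \<le> card (S' (x + \<eta>))" "card (S' (x - \<eta>)) \<le> card S"
    by (auto intro: card_mono)
  show "x \<ge> 0 \<Longrightarrow> real (card S) \<le> 2 * (x + \<eta>) * real q + 1"
    using card(1) card_rational_rotation(1)[OF assms(1,2), of "x + \<eta>" c, folded S'_def] \<eta>0 by linarith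
  show "2 * (x - \<eta>) < 1 \<Longrightarrow> real (card S) \<ge> 2 * (x - \<eta>) * real q - 1"
    using card(2) card_rational_rotation(2)[OF assms(1,2), of "x - \<eta>" c, folded S'_def] by linarith
qed

lemma card_blocks:
  fixes P :: "nat \<Rightarrow> bool"
  shows "card {m. m < R * q \<and> P m} = (\<Sum>t<R. card {i. i < q \<and> P (t * q + i)})"
proof -
  have "card {m. m < R * q \<and> P m} = (\<Sum>m<R * q. of_bool (P m))"
    by (simp add: Int_def lessThan_def flip: card_eq_sum)
  also have "\<dots> = (\<Sum>t<R. \<Sum>m\<in>{t * q..<t * q + q}. of_bool (P m))"
    by (rule sum.nat_group[symmetric])
  also have "\<dots> = (\<Sum>t<R. \<Sum>i<q. of_bool (P (t * q + i)))"
  proof (rule sum.cong[OF refl])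
    fix t
    show "(\<Sum>m\<in>{t * q..<t * q + q}. of_bool (P m)) = (\<Sum>i<q. of_bool (P (t * q + i)) :: nat)"
      by (rule sum.reindex_bij_witness[of _ "\<lambda>i. t * q + i" "\<lambda>m. m - t * q"]) auto
  qed
  also have "\<dots> = (\<Sum>t<R. card {i. i < q \<and> P (t * q + i)})"
    by (simp add: Int_def lessThan_def flip: card_eq_sum)
  finally show ?thesis .
qed

text \<open>Writing \<open>n = d m\<close> leads to the rotation by \<open>d \<alpha>\<close>, which is close to \<open>d p/q = p'/q'\<close> in lowest terms.
  Up to one incomplete run at each end, the possible \<open>m\<close> split into \<open>N / (d q')\<close> runs of length \<open>q'\<close>, each
  with at most \<open>4 q' x\<close> hits; here \<open>q' \<ge> q/k\<close> is long enough for the error terms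
  of each run to be absorbed. The gain of the factor \<open>1/d\<close> is what makes the average over
  prime divisors converge.\<close>
lemma card_multiples_near_int_le:
  fixes \<alpha> x :: real and p :: int and q N d k :: nat
  assumes cop: "coprime p (int q)" and "q > 0"
    and \<alpha>: "\<bar>\<alpha> - of_int p / real q\<bar> \<le> 1 / real q ^ 2"
    and d: "1 \<le> d" "d \<le> k" and q: "2 * real k ^ 2 \<le> real q * x" "k * q \<le> N"
  shows "real (card {n\<in>{N..<2 * N}. d dvd n \<and> dist_nearest_int (real n * \<alpha>) \<le> x})
           \<le> 12 * (real N * x / real d)"
proof -
  define g where "g = gcd d q"
  define q' where "q' = q div g"
  define p' where "p' = p * int (d div g)"
  define \<gamma> where "\<gamma> = real d * \<alpha>"
  have g: "g > 0" "g dvd d" "g dvd q" using \<open>q > 0\<close> by (auto simp: g_def)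
  have qg: "q = q' * g" and dg: "d = (d div g) * g" using g by (auto simp: q'_def)
  have q'0: "q' > 0" using qg \<open>q > 0\<close> by (cases q') auto
  have q'q: "q' \<le> q" using qg \<open>q > 0\<close> by (metis dvd_imp_le dvd_triv_left)
  have gd: "g \<le> d" using g d by (intro dvd_imp_le) auto
  have "coprime (d div g) q'"
    unfolding q'_def g_def using \<open>q > 0\<close> by (intro div_gcd_coprime) auto
  moreover have "coprime p (int q')" using cop qg by simp
  ultimately have cop': "coprime p' (int q')" by (simp add: p'_def)
  have frac: "of_int p' / real q' = real d * (of_int p / real q)"
  proof -
    have "real d * (of_int p / real q) = (real (d div g) * real g) * of_int p / (real q' * real g)"
      using qg dg by (metis of_nat_mult times_divide_eq_right)
    thus ?thesis using g by (simp add: p'_def field_simps)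
  qed
  have "\<bar>\<gamma> - of_int p' / real q'\<bar> = real d * \<bar>\<alpha> - of_int p / real q\<bar>"
    unfolding frac \<gamma>_def by (simp add: abs_mult del: times_divide_eq_right flip: right_diff_distrib)
  also have "\<dots> \<le> real d * (1 / real q ^ 2)" using \<alpha> by (intro mult_left_mono) auto
  finally have "\<bar>\<gamma> - of_int p' / real q'\<bar> * real q' \<le> real d * (1 / real q ^ 2) * real q'"
    by (intro mult_right_mono) auto
  also have "\<dots> \<le> real d * (1 / real q ^ 2) * real q"
    using q'q by (intro mult_left_mono) auto
  also have "\<dots> = real d / real q" using \<open>q > 0\<close> by (simp add: power2_eq_square)
  finally have \<eta>: "\<bar>\<gamma> - of_int p' / real q'\<bar> * real q' \<le> real d / real q" .
  have k0: "real k \<ge> 1" using d by linarith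
  have "real q \<le> real q' * real k"
  proof -
    have "real q = real q' * real g" using qg by (metis of_nat_mult)
    also have "\<dots> \<le> real q' * real k" using gd d by (intro mult_left_mono) auto
    finally show ?thesis .
  qed
  have x0: "x > 0"
  proof -
    have "0 < real q * x" using q(1) k0 by (smt (verit) zero_less_power)
    thus ?thesis using \<open>q > 0\<close> by (simp add: zero_less_mult_iff)
  qed
  have "2 * real k ^ 2 \<le> (real q' * real k) * x"
    using q(1) mult_right_mono[OF \<open>real q \<le> real q' * real k\<close>, of x] x0 by linarith
  hence "real k * (2 * real k) \<le> real k * (real q' * x)" by (simp add: power2_eq_square mult_ac)
  hence "2 * real k \<le> real q' * x" using k0 by (simp add: mult_le_cancel_left)
  hence x_big: "2 * real d + 1 \<le> 2 * (real q' * x)" using d k0 by linarith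
  have run: "real (card {i. i < q' \<and> dist_nearest_int (c + real i * \<gamma>) \<le> x}) \<le> 4 * (real q' * x)" for c
  proof -
    have "real (card {i. i < q' \<and> dist_nearest_int (c + real i * \<gamma>) \<le> x})
        \<le> 2 * (x + real d / real q) * real q' + 1"
      using card_rotation_run(1)[OF q'0 cop' \<eta>] x0 by simp
    also have "\<dots> = 2 * (real q' * x) + 2 * (real d * (real q' / real q)) + 1" by (simp add: algebra_simps)
    also have "real d * (real q' / real q) \<le> real d * 1"
      using q'q \<open>q > 0\<close> by (intro mult_left_mono) auto
    finally show ?thesis using x_big by linarith
  qed
  \<comment> \<open>number of runs; the summand 2 covers both incomplete ones\<close>
  define R where "R = N div (d * q') + 2"
  define m0 where "m0 = N div d"
  have "d * q' \<le> N"
  proof -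
    have "d * q' \<le> k * q" using d q'q by (intro mult_mono) auto
    thus ?thesis using q(2) by linarith
  qed
  have R: "real R \<le> 3 * (real N / (real d * real q'))"
  proof -
    have "real R \<le> real N / real (d * q') + 2" unfolding R_def using of_nat_div_le_of_nat[of N "d * q'", where ?'a = real] by simp
    also have "1 \<le> real N / real (d * q')" using \<open>d * q' \<le> N\<close> d q'0 by (simp add: le_divide_eq del: of_nat_mult)
    hence "real N / real (d * q') + 2 \<le> 3 * (real N / real (d * q'))" by linarith
    finally show ?thesis by simp
  qed
  have "card {n\<in>{N..<2 * N}. d dvd n \<and> dist_nearest_int (real n * \<alpha>) \<le> x}
      \<le> card {m. m < R * q' \<and> dist_nearest_int (real m0 * \<gamma> + real m * \<gamma>) \<le> x}"
  proof (rule card_inj_on_le[of "\<lambda>n. n div d - m0"])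
    have ge: "n div d \<ge> m0" if "n \<ge> N" for n using that by (simp add: m0_def div_le_mono)
    show "inj_on (\<lambda>n. n div d - m0) {n\<in>{N..<2 * N}. d dvd n \<and> dist_nearest_int (real n * \<alpha>) \<le> x}"
    proof
      fix a b assume *: "a \<in> {n\<in>{N..<2 * N}. d dvd n \<and> dist_nearest_int (real n * \<alpha>) \<le> x}"
         "b \<in> {n\<in>{N..<2 * N}. d dvd n \<and> dist_nearest_int (real n * \<alpha>) \<le> x}"
         "a div d - m0 = b div d - m0"
      hence "a div d = b div d" using ge[of a] ge[of b] by auto
      thus "a = b" using * by (metis (no_types, lifting) dvd_div_mult_self mem_Collect_eq)
    qed
    show "(\<lambda>n. n div d - m0) ` {n\<in>{N..<2 * N}. d dvd n \<and> dist_nearest_int (real n * \<alpha>) \<le> x}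
       \<subseteq> {m. m < R * q' \<and> dist_nearest_int (real m0 * \<gamma> + real m * \<gamma>) \<le> x}"
    proof safe
      fix n assume n: "n \<in> {N..<2 * N}" "d dvd n" "dist_nearest_int (real n * \<alpha>) \<le> x"
      then obtain m where m: "n = d * m" by blast
      have nm: "n div d = m" using m d by simp
      have mm: "m \<ge> m0" using ge[of n] n nm by simp
      have "N < d * (m0 + 1)" using dividend_less_times_div[of d N] d by (simp add: m0_def algebra_simps)
      moreover have "N < (d * q') * (N div (d * q') + 1)"
        using dividend_less_times_div[of "d * q'" N] d q'0 by (simp add: algebra_simps)
      ultimately have "d * m < d * (m0 + 1) + (d * q') * (N div (d * q') + 1)" using n m by simp
      also have "\<dots> = d * (m0 + 1 + q' * (N div (d * q') + 1))" by (simp add: algebra_simps)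
      finally have "m < m0 + 1 + q' * (N div (d * q') + 1)" by (simp only: mult_less_cancel1)
      hence "m - m0 < 1 + q' * (N div (d * q') + 1)" using mm by simp
      also have "\<dots> \<le> R * q'" using q'0 by (simp add: R_def algebra_simps)
      finally show "n div d - m0 < R * q'" using nm by simp
      have "real m0 * \<gamma> + real (m - m0) * \<gamma> = real n * \<alpha>"
        using mm by (simp add: m \<gamma>_def algebra_simps of_nat_diff)
      thus "dist_nearest_int (real m0 * \<gamma> + real (n div d - m0) * \<gamma>) \<le> x" using n(3) nm by simp
    qed
  qed simp
  hence "real (card {n\<in>{N..<2 * N}. d dvd n \<and> dist_nearest_int (real n * \<alpha>) \<le> x})
      \<le> real (\<Sum>t<R. card {i. i < q' \<and> dist_nearest_int (real m0 * \<gamma> + real (t * q' + i) * \<gamma>) \<le> x})"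
    unfolding card_blocks by (simp only: of_nat_le_iff)
  also have "\<dots> = (\<Sum>t<R. real (card {i. i < q' \<and> dist_nearest_int ((real m0 + real (t * q')) * \<gamma> + real i * \<gamma>) \<le> x}))"
    by (simp add: algebra_simps)
  also have "\<dots> \<le> (\<Sum>t<R. 4 * (real q' * x))" by (intro sum_mono run)
  also have "\<dots> = real R * (4 * (real q' * x))" by simp
  also have "\<dots> \<le> 3 * (real N / (real d * real q')) * (4 * (real q' * x))"
    using R x0 by (intro mult_right_mono) auto
  also have "\<dots> = 12 * (real N * x / real d)" using q'0 by (simp add: field_simps)
  finally show ?thesis .
qed

lemma card_near_int_ge:
  fixes \<alpha> x :: real and p :: int and q N :: nat
  assumes cop: "coprime p (int q)" and "q > 0"
    and \<alpha>: "\<bar>\<alpha> - of_int p / real q\<bar> \<le> 1 / real q ^ 2"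
    and x: "x \<le> 1 / 2" and q: "3 \<le> real q * x" "q \<le> N"
  shows "real (card {n\<in>{N..<2 * N}. dist_nearest_int (real n * \<alpha>) \<le> x}) \<ge> real N * x / 2"
proof -
  define R where "R = N div q"
  have "\<bar>\<alpha> - of_int p / real q\<bar> * real q \<le> 1 / real q ^ 2 * real q" using \<alpha> by (intro mult_right_mono) auto
  hence \<eta>: "\<bar>\<alpha> - of_int p / real q\<bar> * real q \<le> 1 / real q" using \<open>q > 0\<close> by (simp add: power2_eq_square)
  have run: "real (card {i. i < q \<and> dist_nearest_int (c + real i * \<alpha>) \<le> x}) \<ge> real q * x" for c
  proof -
    have "1 / real q > 0" using \<open>q > 0\<close> by simp
    moreover have "2 * (x - e) < 1" if "e > 0" for e :: real
      using x that by (simp add: field_simps)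
    ultimately have "2 * (x - 1 / real q) < 1" by blast
    hence "real (card {i. i < q \<and> dist_nearest_int (c + real i * \<alpha>) \<le> x}) \<ge> 2 * (x - 1 / real q) * real q - 1"
      using card_rotation_run(2)[OF \<open>q > 0\<close> cop \<eta>] by simp
    also have "2 * (x - 1 / real q) * real q - 1 = 2 * (real q * x) - 3" using \<open>q > 0\<close> by (simp add: field_simps)
    finally show ?thesis using q(1) by linarith
  qed
  have x0: "x > 0" using q(1) \<open>q > 0\<close> by (smt (verit) of_nat_0_less_iff zero_less_mult_iff)
  have Rq: "R * q \<le> N" by (simp add: R_def)
  have R: "real N \<le> 2 * (real R * real q)"
  proof -
    have "N < R * q + q" unfolding R_def using dividend_less_div_times[OF \<open>q > 0\<close>, of N] by simp
    moreover have "R \<ge> 1" unfolding R_def using q(2) \<open>q > 0\<close> by (simp add: Suc_le_eq div_greater_zero_iff)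
    hence "q \<le> R * q" by simp
    ultimately have "N \<le> 2 * (R * q)" by linarith
    thus ?thesis by (metis of_nat_le_iff of_nat_mult of_nat_numeral)
  qed
  have "real N * x / 2 \<le> real R * (real q * x)" using mult_right_mono[OF R, of x] x0 by simp
  also have "\<dots> = (\<Sum>t<R. real q * x)" by simp
  also have "\<dots> \<le> (\<Sum>t<R. real (card {i. i < q \<and> dist_nearest_int ((real N + real (t * q)) * \<alpha> + real i * \<alpha>) \<le> x}))"
    by (intro sum_mono run)
  also have "\<dots> = real (\<Sum>t<R. card {i. i < q \<and> dist_nearest_int (real (N + (t * q + i)) * \<alpha>) \<le> x})"
    by (simp add: algebra_simps)
  also have "\<dots> = real (card {m. m < R * q \<and> dist_nearest_int (real (N + m) * \<alpha>) \<le> x})"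
    unfolding card_blocks ..
  also have "card {m. m < R * q \<and> dist_nearest_int (real (N + m) * \<alpha>) \<le> x}
     \<le> card {n\<in>{N..<2 * N}. dist_nearest_int (real n * \<alpha>) \<le> x}"
    by (rule card_inj_on_le[of "\<lambda>m. N + m"]) (use Rq in auto)
  finally show ?thesis by simp
qed

section \<open>Restriction to integers with a large totient\<close>

text \<open>By the product formula, since \<open>1 - t \<ge> exp (- 2 t)\<close> for \<open>0 \<le> t \<le> 1/2\<close>.\<close>
lemma totient_ge_exp:
  assumes "n > 0"
  shows "real (totient n) \<ge> real n * exp (- 2 * (\<Sum>p\<in>prime_factors n. 1 / real p))"
proof -
  have "exp (- 2 * (\<Sum>p\<in>prime_factors n. 1 / real p)) = (\<Prod>p\<in>prime_factors n. exp (- 2 * (1 / real p)))"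
    by (simp add: sum_distrib_left exp_sum)
  also have "\<dots> \<le> (\<Prod>p\<in>prime_factors n. 1 - 1 / real p)"
  proof (intro prod_mono conjI)
    fix p assume "p \<in> prime_factors n"
    hence "p \<ge> 2" by (meson in_prime_factors_iff prime_ge_2_nat)
    define t where "t = 1 / real p"
    have t: "0 \<le> t" "t \<le> 1 / 2" using \<open>p \<ge> 2\<close> by (auto simp: t_def field_simps)
    have "- 2 * t \<le> - t - 2 * t\<^sup>2" using t mult_right_mono[of t "1/2" t] by (simp add: power2_eq_square)
    also have "\<dots> \<le> ln (1 - t)" using t by (rule ln_one_minus_pos_lower_bound)
    finally show "exp (- 2 * (1 / real p)) \<le> 1 - 1 / real p"
      using t unfolding t_def[symmetric] by (subst (asm) ln_ge_iff) auto
  qed simp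
  finally show ?thesis using totient_formula2[of n] by (simp add: mult_left_mono)
qed

lemma sum_inverse_squares_le: "(\<Sum>d\<in>{2..k}. 1 / real d ^ 2) \<le> 1"
proof -
  have *: "(\<Sum>d\<in>{2..k}. 1 / real d ^ 2) \<le> 1 - 1 / real k" if "k \<ge> 1" for k
    using that
  proof (induction k rule: dec_induct)
    case (step k)
    have "1 / real (Suc k) ^ 2 \<le> 1 / (real k * real (Suc k))"
      using step(1) by (intro divide_left_mono) (auto simp: power2_eq_square)
    also have "\<dots> = 1 / real k - 1 / real (Suc k)" using step(1) by (simp add: field_simps)
    finally have "1 / real (Suc k) ^ 2 \<le> 1 / real k - 1 / real (Suc k)" .
    moreover have "(\<Sum>d\<in>{2..Suc k}. 1 / real d ^ 2) = (\<Sum>d\<in>{2..k}. 1 / real d ^ 2) + 1 / real (Suc k) ^ 2"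
      using step(1) by (subst sum.cl_ivl_Suc) auto
    ultimately show ?case using step.IH by linarith
  qed simp
  show ?thesis
  proof (cases "k \<ge> 1")
    case True
    have "1 / real k \<ge> 0" by simp
    thus ?thesis using *[OF True] by linarith
  qed simp
qed

text \<open>A number below \<open>2\<^sup>k\<^sup>+\<^sup>1\<close> has at most \<open>k\<close> prime factors, and each counted one contributes less than
  \<open>1/k\<close>. Thus only primes up to \<open>k\<close> have to be averaged over, and for these the divisibility
  counts are available.\<close>
lemma sum_large_prime_factors_le:
  assumes "0 < n" "n < 2 ^ Suc k"
  shows "(\<Sum>p\<in>{p\<in>prime_factors n. k < p}. 1 / real p) \<le> 1"
proof -
  let ?A = "{p\<in>prime_factors n. k < p}"
  have "2 ^ card ?A = (\<Prod>p\<in>?A. 2::nat)" by simp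
  also have "\<dots> \<le> (\<Prod>p\<in>?A. p)"
    by (intro prod_mono) (auto simp: in_prime_factors_iff prime_ge_2_nat)
  also have "\<dots> \<le> (\<Prod>p\<in>prime_factors n. p)"
    by (intro dvd_imp_le prod_dvd_prod_subset prod_pos) (auto simp: in_prime_factors_iff prime_gt_0_nat)
  also have "\<dots> \<le> (\<Prod>p\<in>prime_factors n. p ^ multiplicity p n)"
  proof (intro prod_mono conjI)
    fix p assume "p \<in> prime_factors n"
    hence "multiplicity p n \<ge> 1" "p \<ge> 1"
      using assms by (auto simp: prime_factors_multiplicity prime_gt_0_nat Suc_le_eq)
    thus "p \<le> p ^ multiplicity p n" by (metis power_increasing power_one_right)
  qed simp
  also have "\<dots> = n" using assms by (intro prime_factorization_nat[symmetric]) auto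
  finally have "2 ^ card ?A < (2::nat) ^ Suc k" using assms by linarith
  hence ck: "card ?A \<le> k" using power_less_imp_less_exp[of "2::nat" "card ?A" "Suc k"] by linarith
  have "(\<Sum>p\<in>?A. 1 / real p) \<le> (\<Sum>p\<in>?A. 1 / real (Suc k))"
    by (intro sum_mono) (auto simp: field_simps)
  also have "\<dots> = real (card ?A) / real (Suc k)" by simp
  also have "\<dots> \<le> 1" using ck by simp
  finally show ?thesis .
qed

text \<open>At least \<open>2\<^sup>k x / 2\<close> integers \<open>n\<close> of the block satisfy \<open>\<parallel>n \<alpha>\<parallel> \<le> x\<close>. Summed over them,
  the reciprocals of their prime divisors up to \<open>k\<close> give at most \<open>12 \<cdot> 2\<^sup>k x \<Sum> 1/d\<^sup>2\<close>.
  By Markov's inequality this sum of reciprocals exceeds 48 for at most half of them. The others have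
  \<open>\<Sum> 1/p \<le> 48 + 1\<close> over all prime divisors, whence the constant \<open>exp (-98)\<close>.\<close>
lemma card_near_int_large_totient_ge:
  fixes \<alpha> x :: real and p :: int and q k :: nat
  assumes cop: "coprime p (int q)" and "q > 0"
    and \<alpha>: "\<bar>\<alpha> - of_int p / real q\<bar> \<le> 1 / real q ^ 2"
    and x: "x \<le> 1 / 2" and "2 \<le> k" and q: "2 * real k ^ 2 \<le> real q * x" "k * q \<le> 2 ^ k"
  shows "real (card {n\<in>{2 ^ k..<2 * 2 ^ k}. dist_nearest_int (real n * \<alpha>) \<le> x
                        \<and> exp (-98) * real n \<le> real (totient n)}) \<ge> 2 ^ k * x / 4"
proof -
  define N :: nat where "N = 2 ^ k"
  define T where "T = {n\<in>{N..<2 * N}. dist_nearest_int (real n * \<alpha>) \<le> x}"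
  define s where "s n = (\<Sum>p\<in>{p\<in>prime_factors n. p \<le> k}. 1 / real p)" for n
  define B where "B = {n\<in>T. s n > 48}"
  have fin: "finite T" by (simp add: T_def)
  have "4 \<le> real k ^ 2" using power_mono[of 2 "real k" 2] \<open>2 \<le> k\<close> by simp
  hence qx: "3 \<le> real q * x" using q(1) by linarith
  hence x0: "x > 0" using \<open>q > 0\<close> by (smt (verit) of_nat_0_less_iff zero_less_mult_iff)
  have "q \<le> k * q" using \<open>2 \<le> k\<close> by simp
  hence qN: "q \<le> N" "k * q \<le> N" using q(2) unfolding N_def by linarith+
  have T: "real (card T) \<ge> real N * x / 2"
    unfolding T_def by (rule card_near_int_ge[OF cop \<open>q > 0\<close> \<alpha> x qx qN(1)])
  have "(\<Sum>n\<in>T. s n) = (\<Sum>n\<in>T. \<Sum>p\<in>{p\<in>{2..k}. prime p}. if p dvd n then 1 / real p else 0)"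
  proof (rule sum.cong[OF refl])
    fix n assume "n \<in> T"
    hence "n > 0" by (auto simp: T_def N_def)
    hence "{p\<in>prime_factors n. p \<le> k} = {p\<in>{2..k}. prime p} \<inter> {p. p dvd n}"
      by (auto simp: in_prime_factors_iff prime_ge_2_nat)
    thus "s n = (\<Sum>p\<in>{p\<in>{2..k}. prime p}. if p dvd n then 1 / real p else 0)"
      unfolding s_def by (simp add: sum.If_cases)
  qed
  also have "\<dots> = (\<Sum>p\<in>{p\<in>{2..k}. prime p}. \<Sum>n\<in>T. if p dvd n then 1 / real p else 0)"
    by (rule sum.swap)
  also have "\<dots> = (\<Sum>p\<in>{p\<in>{2..k}. prime p}. real (card {n\<in>T. p dvd n}) / real p)"
    using fin by (intro sum.cong refl) (simp add: sum.If_cases Int_def conj_commute)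
  also have "\<dots> \<le> (\<Sum>p\<in>{2..k}. real (card {n\<in>T. p dvd n}) / real p)"
    by (intro sum_mono2) auto
  also have "\<dots> \<le> (\<Sum>p\<in>{2..k}. 12 * (real N * x) * (1 / real p ^ 2))"
  proof (intro sum_mono)
    fix d assume d: "d \<in> {2..k}"
    have "{n\<in>T. d dvd n} = {n\<in>{N..<2 * N}. d dvd n \<and> dist_nearest_int (real n * \<alpha>) \<le> x}"
      by (auto simp: T_def)
    hence "real (card {n\<in>T. d dvd n}) \<le> 12 * (real N * x / real d)"
      using card_multiples_near_int_le[OF cop \<open>q > 0\<close> \<alpha> _ _ q(1) qN(2), of d] d by simp
    hence "real (card {n\<in>T. d dvd n}) / real d \<le> 12 * (real N * x / real d) / real d"
      by (intro divide_right_mono) auto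
    thus "real (card {n\<in>T. d dvd n}) / real d \<le> 12 * (real N * x) * (1 / real d ^ 2)"
      by (simp add: power2_eq_square)
  qed
  also have "\<dots> \<le> 12 * (real N * x)"
    using mult_left_mono[OF sum_inverse_squares_le[of k], of "12 * (real N * x)"] x0
    by (simp add: sum_distrib_left)
  finally have sum_s: "(\<Sum>n\<in>T. s n) \<le> 12 * (real N * x)" .
  have s0: "s n \<ge> 0" for n unfolding s_def by (intro sum_nonneg) auto
  have "48 * real (card B) = (\<Sum>n\<in>B. 48)" by simp
  also have "\<dots> \<le> (\<Sum>n\<in>B. s n)" by (intro sum_mono) (auto simp: B_def)
  also have "\<dots> \<le> (\<Sum>n\<in>T. s n)" using fin s0 by (intro sum_mono2) (auto simp: B_def)
  finally have B: "real (card B) \<le> real N * x / 4" using sum_s by linarith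
  have "T - B \<subseteq> {n\<in>{2 ^ k..<2 * 2 ^ k}. dist_nearest_int (real n * \<alpha>) \<le> x
                        \<and> exp (-98) * real n \<le> real (totient n)}"
  proof safe
    fix n assume n: "n \<in> T" "n \<notin> B"
    hence n': "n > 0" "n < 2 ^ Suc k" by (auto simp: T_def N_def)
    have "(\<Sum>p\<in>prime_factors n. 1 / real p) = s n + (\<Sum>p\<in>{p\<in>prime_factors n. k < p}. 1 / real p)"
      unfolding s_def by (subst sum.union_disjoint[symmetric]) (auto intro!: sum.cong)
    also have "\<dots> \<le> 48 + 1" using n sum_large_prime_factors_le[OF n'] by (intro add_mono) (auto simp: B_def)
    finally have "exp (-98) \<le> exp (- 2 * (\<Sum>p\<in>prime_factors n. 1 / real p))" by simp
    hence "exp (-98) * real n \<le> real n * exp (- 2 * (\<Sum>p\<in>prime_factors n. 1 / real p))"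
      by (simp add: mult.commute mult_left_mono)
    also have "\<dots> \<le> real (totient n)" by (rule totient_ge_exp[OF n'(1)])
    finally show "exp (-98) * real n \<le> real (totient n)" .
  qed (auto simp: T_def N_def)
  hence "card (T - B) \<le> card {n\<in>{2 ^ k..<2 * 2 ^ k}. dist_nearest_int (real n * \<alpha>) \<le> x
                        \<and> exp (-98) * real n \<le> real (totient n)}"
    by (rule card_mono[rotated]) simp
  moreover have "real (card (T - B)) = real (card T) - real (card B)"
    using fin by (subst card_Diff_subset) (auto simp: B_def of_nat_diff card_mono)
  ultimately show ?thesis using T B by (simp add: N_def)
qed

section \<open>Neighbourhoods of reduced fractions\<close>

text \<open>The Cauchy-Schwarz inequality for the sum of the indicators of the \<open>A i\<close> and the indicator of their
  union, in the form that the integral of the square of \<open>\<Sum>\<^sub>i 1\<^bsub>A i\<^esub> - t \<cdot> 1\<^bsub>U\<^esub>\<close> is nonnegative for all \<open>t\<close>.\<close>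
lemma chung_erdos:
  fixes A :: "'i \<Rightarrow> 'a set"
  assumes "finite F" and A: "\<And>i. i \<in> F \<Longrightarrow> A i \<in> fmeasurable M"
  shows "(\<Sum>i\<in>F. measure M (A i))\<^sup>2
       \<le> measure M (\<Union>i\<in>F. A i) * (\<Sum>i\<in>F. \<Sum>j\<in>F. measure M (A i \<inter> A j))"
proof -
  define U where "U = (\<Union>i\<in>F. A i)"
  define s1 where "s1 = (\<Sum>i\<in>F. measure M (A i))"
  define s2 where "s2 = (\<Sum>i\<in>F. \<Sum>j\<in>F. measure M (A i \<inter> A j))"
  have U: "U \<in> fmeasurable M" unfolding U_def using assms by (intro fmeasurable.finite_UN) auto
  have AA: "A i \<inter> A j \<in> fmeasurable M" if "i \<in> F" "j \<in> F" for i j using A that by auto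
  have ind: "integrable M (indicator B :: 'a \<Rightarrow> real)" "integral\<^sup>L M (indicator B :: 'a \<Rightarrow> real) = measure M B"
    if "B \<in> fmeasurable M" for B
    using that sets.sets_into_space[of B M] by (auto simp: fmeasurable_def Int_absorb2)
  have quad: "0 \<le> s2 - 2 * t * s1 + t\<^sup>2 * measure M U" for t
  proof -
    define h :: "'a \<Rightarrow> real" where "h x = (\<Sum>i\<in>F. \<Sum>j\<in>F. indicator (A i \<inter> A j) x)
       - 2 * t * (\<Sum>i\<in>F. indicator (A i) x) + t\<^sup>2 * indicator U x" for x
    have "h x = ((\<Sum>i\<in>F. indicator (A i) x) - t * indicator U x)\<^sup>2" for x
    proof (cases "x \<in> U")
      case True
      thus ?thesis
        by (simp add: h_def power2_eq_square sum_product indicator_inter_arith algebra_simps)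
    next
      case False
      hence "indicator (A i) x = (0::real)" "indicator (A i \<inter> A j) x = (0::real)" if "i \<in> F" for i j
        using that by (auto simp: U_def)
      thus ?thesis using False by (simp add: h_def)
    qed
    hence "0 \<le> integral\<^sup>L M h" by (intro integral_nonneg_AE) auto
    also have "integral\<^sup>L M h = s2 - 2 * t * s1 + t\<^sup>2 * measure M U"
      unfolding h_def using ind A AA U
      by (simp add: s1_def s2_def)
    finally show ?thesis .
  qed
  have "s1\<^sup>2 \<le> measure M U * s2"
  proof (cases "measure M U = 0")
    case True
    have "measure M (A i) = 0" if "i \<in> F" for i
      using measure_mono_fmeasurable[of "A i" U M] A[OF that] U that True
      by (auto simp: U_def measure_le_0_iff fmeasurableD)
    hence "s1 = 0" by (simp add: s1_def)
    thus ?thesis using True by simp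
  next
    case False
    hence u: "measure M U > 0" by (simp add: zero_less_measure_iff)
    \<comment> \<open>the minimum of the quadratic\<close>
    have "0 \<le> s2 - 2 * (s1 / measure M U) * s1 + (s1 / measure M U)\<^sup>2 * measure M U" by (rule quad)
    also have "\<dots> = s2 - s1\<^sup>2 / measure M U" using u by (simp add: power2_eq_square field_simps)
    finally show ?thesis using u by (simp add: field_simps)
  qed
  thus ?thesis by (simp add: s1_def s2_def U_def)
qed

text \<open>Solutions of \<open>\<bar>n x - a\<bar> < r\<close> with \<open>a\<close> coprime to \<open>n\<close>. Numerators range over
  \<open>1, \<dots>, n\<close> rather than all integers, so that for \<open>n \<ge> 2\<close> and \<open>r \<le> 1/2\<close> the set stays inside the unit interval.\<close>
definition reduced_nbhd :: "nat \<Rightarrow> real \<Rightarrow> real set" where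
  "reduced_nbhd n r = (\<Union>a\<in>totatives n. {(real a - r) / real n <..< (real a + r) / real n})"

lemma open_reduced_nbhd: "open (reduced_nbhd n r)"
  unfolding reduced_nbhd_def by auto

lemma lmeasurable_reduced_nbhd: "reduced_nbhd n r \<in> lmeasurable"
  unfolding reduced_nbhd_def by (intro fmeasurable.finite_UN) (auto intro: lmeasurable_open)

lemma measure_Ioo: "measure lebesgue {a<..<b::real} = (if a \<le> b then b - a else 0)"
  using measure_completion[of "{a<..<b}" lborel] by simp

lemma reduced_nbhd_subset:
  assumes "n \<ge> 2" "r \<le> 1 / 2" shows "reduced_nbhd n r \<subseteq> {0..1}"
proof
  fix x assume "x \<in> reduced_nbhd n r"
  then obtain a where a: "a \<in> totatives n" "(real a - r) / real n < x" "x < (real a + r) / real n"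
    by (auto simp: reduced_nbhd_def)
  have "0 < a" "a < n" using a(1) assms by (auto simp: in_totatives_iff totatives_less)
  hence "0 \<le> (real a - r) / real n" "(real a + r) / real n \<le> 1" using assms by (auto simp: field_simps)
  thus "x \<in> {0..1}" using a(2,3) by auto
qed

lemma reduced_nbhdD:
  assumes "x \<in> reduced_nbhd n r"
  shows "dist_nearest_int (real n * x) < r"
proof -
  obtain a where a: "a \<in> totatives n" "(real a - r) / real n < x" "x < (real a + r) / real n"
    using assms by (auto simp: reduced_nbhd_def)
  have "n > 0" using a(1) by (cases n) auto
  hence "\<bar>real n * x - of_int (int a)\<bar> < r" using a by (auto simp: field_simps abs_less_iff)
  thus ?thesis using round_diff_minimal[of "real n * x" "int a"] by (simp add: dist_nearest_int_def)
qed

lemma measure_reduced_nbhd: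
  assumes "0 \<le> r" "r \<le> 1 / 2" "n > 0"
  shows "measure lebesgue (reduced_nbhd n r) = 2 * r * real (totient n) / real n"
proof -
  have "measure lebesgue (reduced_nbhd n r)
      = (\<Sum>a\<in>totatives n. measure lebesgue {(real a - r) / real n <..< (real a + r) / real n})"
    unfolding reduced_nbhd_def
  proof (rule measure_UNION')
    show "pairwise (\<lambda>a b. disjnt {(real a - r) / real n <..< (real a + r) / real n}
                                 {(real b - r) / real n <..< (real b + r) / real n}) (totatives n)"
    proof (rule pairwiseI)
      fix a b :: nat assume "a \<noteq> b"
      hence *: "real a + 1 \<le> real b \<or> real b + 1 \<le> real a" by linarith
      have False if "x \<in> {(real a - r) / real n <..< (real a + r) / real n}"
         "x \<in> {(real b - r) / real n <..< (real b + r) / real n}" for x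
      proof -
        have "real a - r < x * real n" "x * real n < real a + r" "real b - r < x * real n" "x * real n < real b + r"
          using that assms(3) by (auto simp: pos_divide_less_eq pos_less_divide_eq)
        thus False using * assms(2) by linarith
      qed
      thus "disjnt {(real a - r) / real n <..< (real a + r) / real n}
                   {(real b - r) / real n <..< (real b + r) / real n}"
        unfolding disjnt_def by blast
    qed
  qed (auto intro: lmeasurable_open)
  also have "\<dots> = (\<Sum>a\<in>totatives n. 2 * r / real n)"
    using assms by (intro sum.cong refl) (simp add: measure_Ioo divide_right_mono flip: diff_divide_distrib)
  also have "\<dots> = 2 * r * real (totient n) / real n" by (simp add: totient_def)
  finally show ?thesis .
qed

text \<open>The integer \<open>a n - b m\<close> is a nonzero multiple \<open>k d\<close> of \<open>d = gcd m n\<close>: it could vanish only if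
  the reduced fractions \<open>a/m\<close> and \<open>b/n\<close> coincided. So at most \<open>2 K / d\<close> values of \<open>k\<close> occur. Each is
  taken at most \<open>d\<close> times, because \<open>k\<close> determines \<open>a\<close> modulo \<open>m / d\<close> and then \<open>b\<close>. Excluding \<open>k = 0\<close>
  is the reason for using reduced fractions: otherwise there would be an additional term \<open>d\<close>, which is too large
  on average.\<close>
lemma card_close_reduced_fractions_le:
  fixes m n :: nat and K :: real
  assumes mn: "m > 0" "n > 0" "m \<noteq> n" and K: "K \<ge> 0"
  defines "P \<equiv> {(a, b). a \<in> totatives m \<and> b \<in> totatives n \<and> \<bar>real a * real n - real b * real m\<bar> < K}"
  shows "finite P" "real (card P) \<le> 2 * K"
proof -
  define d where "d = gcd m n"
  define m' where "m' = m div d"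
  define n' where "n' = n div d"
  have d: "d > 0" using mn by (simp add: d_def)
  have m: "m = m' * d" and n: "n = n' * d" by (auto simp: m'_def n'_def d_def)
  have cop: "coprime m' n'" unfolding m'_def n'_def d_def using mn by (intro div_gcd_coprime) auto
  have m'0: "m' > 0" and n'0: "n' > 0" using m n mn by (auto intro: Nat.gr0I)
  define L where "L = \<lfloor>K / real d\<rfloor>"
  have L: "real_of_int L \<le> K / real d" "L \<ge> 0" using K by (auto simp: L_def)
  define Q where "Q = ({- L..-1} \<union> {1..L}) \<times> {..<d}"
  define g where "g = (\<lambda>(a, b). (int a * int n' - int b * int m', (a - 1) div m'))"
  show "finite P" unfolding P_def
    by (rule finite_subset[of _ "totatives m \<times> totatives n"]) auto
  have "g (a, b) \<in> Q" if "(a, b) \<in> P" for a b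
  proof -
    from that have ab: "a \<in> totatives m" "b \<in> totatives n" "\<bar>real a * real n - real b * real m\<bar> < K"
      by (auto simp: P_def)
    define k where "k = int a * int n' - int b * int m'"
    have "k \<noteq> 0"
    proof
      assume "k = 0"
      hence "int (a * n') = int (b * m')" by (simp add: k_def)
      hence eq: "a * n' = b * m'" by (simp only: of_nat_eq_iff)
      hence "a * n = b * m" by (simp add: m n)
      hence "m dvd n" "n dvd m" using ab(1,2)
        by (metis coprime_commute coprime_dvd_mult_right_iff dvd_triv_right in_totatives_iff)+
      thus False using mn(3) by (simp add: dvd_antisym)
    qed
    have "real a * real n - real b * real m = real_of_int k * real d"
      by (simp add: m n k_def algebra_simps)
    hence "\<bar>real_of_int k\<bar> * real d < K" using ab(3) by (simp add: abs_mult)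
    hence "real_of_int \<bar>k\<bar> \<le> K / real d" using d by (simp add: field_simps)
    hence "\<bar>k\<bar> \<le> L" by (simp add: L_def le_floor_iff)
    hence "k \<in> {- L..-1} \<union> {1..L}" using \<open>k \<noteq> 0\<close> by auto
    moreover have "(a - 1) div m' < d"
    proof -
      have "a - 1 < m" using ab(1) mn by (auto simp: in_totatives_iff)
      thus ?thesis using m by (simp add: less_mult_imp_div_less mult.commute)
    qed
    ultimately show ?thesis by (simp add: g_def Q_def k_def)
  qed
  hence gP: "g ` P \<subseteq> Q" by auto
  have inj: "inj_on g P"
  proof (rule inj_onI, clarify)
    fix a b a' b'
    assume P: "(a, b) \<in> P" "(a', b') \<in> P" and "g (a, b) = g (a', b')"
    hence eq: "int a * int n' - int b * int m' = int a' * int n' - int b' * int m'"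
      and dv: "(a - 1) div m' = (a' - 1) div m'" by (auto simp: g_def)
    have a: "a \<ge> 1" "a' \<ge> 1" using P by (auto simp: P_def in_totatives_iff)
    have "(int a - int a') * int n' = (int b - int b') * int m'" using eq by (simp add: algebra_simps)
    hence "int m' dvd (int a - int a') * int n'" by simp
    hence "int m' dvd int a - int a'" using cop by (simp add: coprime_dvd_mult_left_iff)
    hence "int m' dvd int (a - 1) - int (a' - 1)" using a by (simp add: of_nat_diff)
    hence "(a - 1) mod m' = (a' - 1) mod m'" by (metis cong_def cong_iff_dvd_diff cong_int_iff)
    hence "a - 1 = a' - 1" using dv by (metis div_mult_mod_eq)
    hence "a = a'" using a by linarith
    moreover from this have "b = b'" using eq m'0 by simp
    ultimately show "a = a' \<and> b = b'" by simp
  qed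
  have "card P \<le> card Q" by (rule card_inj_on_le[OF inj gP]) (simp add: Q_def)
  also have "card Q = (nat L + nat L) * d"
    unfolding Q_def by (simp add: card_cartesian_product card_Un_disjoint)
  also have "real ((nat L + nat L) * d) = (2 * of_int L) * real d" using L(2) by simp
  also have "\<dots> \<le> (2 * (K / real d)) * real d"
    using L(1) by (intro mult_right_mono mult_left_mono) auto
  finally show "real (card P) \<le> 2 * K" using d by simp
qed

text \<open>With \<open>u = r/m\<close> and \<open>v = s/n\<close>, two intervals meet in at most \<open>2 min u v\<close>, and at most
  \<open>2 m n (u + v)\<close> pairs of intervals meet at all; finally \<open>(u + v) min u v \<le> 2 u v\<close>.\<close>
lemma measure_reduced_nbhd_overlap:
  fixes m n :: nat and r s :: real
  assumes mn: "m > 0" "n > 0" "m \<noteq> n" and rs: "r \<ge> 0" "s \<ge> 0"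
  shows "measure lebesgue (reduced_nbhd m r \<inter> reduced_nbhd n s) \<le> 8 * r * s"
proof -
  define I where "I n r a = {(real a - r) / real n <..< (real a + r) / real n}" for n r and a :: nat
  define K where "K = r * real n + s * real m"
  define P where "P = {(a, b). a \<in> totatives m \<and> b \<in> totatives n \<and> \<bar>real a * real n - real b * real m\<bar> < K}"
  have K: "K \<ge> 0" using rs by (simp add: K_def)
  note P = card_close_reduced_fractions_le[OF mn K, folded P_def]
  define u where "u = r / real m"
  define v where "v = s / real n"
  have uv: "u \<ge> 0" "v \<ge> 0" "r = u * real m" "s = v * real n" using mn rs by (auto simp: u_def v_def)
  have lI: "I n r a \<in> lmeasurable" for n r a unfolding I_def by (intro lmeasurable_open) auto
  have mI: "measure lebesgue (I n r a) \<le> 2 * (r / real n)" if "r \<ge> 0" for n r a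
    using that by (simp add: I_def measure_Ioo flip: diff_divide_distrib)
  have one: "measure lebesgue (I m r a \<inter> I n s b) \<le> 2 * min u v" for a b
  proof -
    have "measure lebesgue (I m r a \<inter> I n s b) \<le> measure lebesgue (I m r a)"
      "measure lebesgue (I m r a \<inter> I n s b) \<le> measure lebesgue (I n s b)"
      using lI by (auto intro!: measure_mono_fmeasurable)
    thus ?thesis using mI[OF rs(1), of m a] mI[OF rs(2), of n b] by (simp add: u_def v_def)
  qed
  have "reduced_nbhd m r \<inter> reduced_nbhd n s \<subseteq> (\<Union>(a, b)\<in>P. I m r a \<inter> I n s b)"
  proof
    fix x assume "x \<in> reduced_nbhd m r \<inter> reduced_nbhd n s"
    then obtain a b where ab: "a \<in> totatives m" "b \<in> totatives n" "x \<in> I m r a" "x \<in> I n s b"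
      by (auto simp: reduced_nbhd_def I_def)
    have "\<bar>real a - x * real m\<bar> < r" "\<bar>x * real n - real b\<bar> < s"
      using ab mn by (auto simp: I_def field_simps abs_less_iff)
    hence "\<bar>real a - x * real m\<bar> * real n < r * real n" "\<bar>x * real n - real b\<bar> * real m < s * real m"
      using mn by auto
    hence "\<bar>(real a - x * real m) * real n\<bar> < r * real n" "\<bar>(x * real n - real b) * real m\<bar> < s * real m"
      by (simp_all add: abs_mult)
    moreover have "real a * real n - real b * real m = (real a - x * real m) * real n + (x * real n - real b) * real m"
      by (simp add: algebra_simps)
    ultimately have "\<bar>real a * real n - real b * real m\<bar> < K" unfolding K_def by linarith
    thus "x \<in> (\<Union>(a, b)\<in>P. I m r a \<inter> I n s b)" using ab by (auto simp: P_def)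
  qed
  hence "measure lebesgue (reduced_nbhd m r \<inter> reduced_nbhd n s) \<le> measure lebesgue (\<Union>(a, b)\<in>P. I m r a \<inter> I n s b)"
    using P(1) lI lmeasurable_reduced_nbhd
    by (intro measure_mono_fmeasurable fmeasurable.finite_UN) (auto intro!: fmeasurable.Int fmeasurableD)
  also have "\<dots> \<le> (\<Sum>(a, b)\<in>P. measure lebesgue (I m r a \<inter> I n s b))"
    using measure_UNION_le[OF P(1), of "\<lambda>(a, b). I m r a \<inter> I n s b" lebesgue] lI
    by (auto simp: case_prod_unfold fmeasurableD)
  also have "\<dots> \<le> (\<Sum>(a, b)\<in>P. 2 * min u v)" by (intro sum_mono) (auto intro: one)
  also have "\<dots> = real (card P) * (2 * min u v)" by (simp add: case_prod_unfold)
  also have "\<dots> \<le> 2 * K * (2 * min u v)" using P(2) uv by (intro mult_right_mono) auto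
  also have "\<dots> = 4 * (real m * real n) * ((u + v) * min u v)"
    by (simp add: K_def uv(3,4) algebra_simps)
  also have "(u + v) * min u v \<le> 2 * (u * v)"
  proof (cases "u \<le> v")
    case True
    thus ?thesis using mult_left_mono[of u v u] uv by (simp add: algebra_simps)
  next
    case False
    thus ?thesis using mult_left_mono[of v u v] uv by (simp add: algebra_simps)
  qed
  hence "4 * (real m * real n) * ((u + v) * min u v) \<le> 4 * (real m * real n) * (2 * (u * v))"
    by (intro mult_left_mono) auto
  also have "\<dots> = 8 * r * s" by (simp add: uv(3,4))
  finally show ?thesis .
qed

text \<open>For a finite set of indices with \<open>s = \<Sum> f n \<ge> 1\<close> the measures add up to at least \<open>2 c s\<close>
  and the pairwise overlaps to at most \<open>8 s\<^sup>2 + 2 s \<le> 10 s\<^sup>2\<close>, so by the Chung-Erdos inequality the union has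
  measure at least \<open>4 c\<^sup>2 / 10\<close>. The divergence of \<open>\<Sum> f n\<close> provides such index sets beyond every bound, and
  the estimate passes to the limsup set by continuity from above.\<close>
lemma measure_limsup_reduced_nbhd_ge:
  fixes f :: "nat \<Rightarrow> real" and c :: real and G :: "nat set"
  assumes c: "c > 0" and f: "\<And>n. n \<in> G \<Longrightarrow> 0 \<le> f n \<and> f n \<le> 1 / 2"
    and G: "\<And>n. n \<in> G \<Longrightarrow> n \<ge> 2 \<and> c * real n \<le> real (totient n)"
    and div: "\<And>N. \<exists>F. finite F \<and> F \<subseteq> G \<inter> {N..} \<and> (\<Sum>n\<in>F. f n) \<ge> 1"
  defines "L \<equiv> {x. \<exists>\<^sub>\<infinity>n. n \<in> G \<and> x \<in> reduced_nbhd n (f n)}"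
  shows "L \<in> sets borel" "L \<subseteq> {0..1}" "measure lebesgue L \<ge> 2 * c\<^sup>2 / 5"
proof -
  define V where "V N = (\<Union>n\<in>G \<inter> {N..}. reduced_nbhd n (f n))" for N
  have LV: "L = (\<Inter>N. V N)" unfolding L_def V_def INFM_nat_le by auto
  have Vo: "open (V N)" for N unfolding V_def using open_reduced_nbhd by auto
  thus "L \<in> sets borel" unfolding LV by (intro sets.countable_INT) auto
  have V01: "V N \<subseteq> {0..1}" for N unfolding V_def using reduced_nbhd_subset f G by blast
  thus "L \<subseteq> {0..1}" unfolding LV by blast
  have Vm: "V N \<in> lmeasurable" for N using Vo V01[of N] bounded_subset[OF bounded_closed_interval]
    by (metis box_real(2) bounded_cbox bounded_subset lmeasurable_open)
  have V: "measure lebesgue (V N) \<ge> 2 * c\<^sup>2 / 5" for N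
  proof -
    obtain F where F: "finite F" "F \<subseteq> G \<inter> {N..}" "(\<Sum>n\<in>F. f n) \<ge> 1" using div by blast
    define A where "A n = reduced_nbhd n (f n)" for n
    define s where "s = (\<Sum>n\<in>F. f n)"
    define s1 where "s1 = (\<Sum>n\<in>F. measure lebesgue (A n))"
    define s2 where "s2 = (\<Sum>m\<in>F. \<Sum>n\<in>F. measure lebesgue (A m \<inter> A n))"
    have FG: "f n \<ge> 0" "f n \<le> 1/2" "n > 0" "c * real n \<le> real (totient n)" if "n \<in> F" for n
      using f[of n] G[of n] F(2) that by auto
    have mA: "measure lebesgue (A n) = 2 * f n * (real (totient n) / real n)" if "n \<in> F" for n
      using measure_reduced_nbhd FG[OF that] by (simp add: A_def)
    have lower: "2 * c * f n \<le> measure lebesgue (A n)" if "n \<in> F" for n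
    proof -
      have "c \<le> real (totient n) / real n" using FG[OF that] by (simp add: field_simps)
      hence "2 * f n * c \<le> 2 * f n * (real (totient n) / real n)"
        using FG[OF that] by (intro mult_left_mono) auto
      thus ?thesis unfolding mA[OF that] by (simp only: mult_ac)
    qed
    have upper: "measure lebesgue (A n) \<le> 2 * f n" if "n \<in> F" for n
    proof -
      have "real (totient n) / real n \<le> 1" using FG[OF that] totient_le[of n] by simp
      thus ?thesis unfolding mA[OF that] using FG[OF that] mult_left_mono[of "real (totient n) / real n" 1 "2 * f n"] by simp
    qed
    have s: "s \<ge> 1" using F(3) by (simp add: s_def)
    have "2 * c * s = (\<Sum>n\<in>F. 2 * c * f n)" by (simp add: s_def sum_distrib_left)
    also have "\<dots> \<le> s1" unfolding s1_def by (intro sum_mono lower)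
    finally have "(2 * c * s)\<^sup>2 \<le> s1\<^sup>2" using c s by (intro power_mono) auto
    also have "s1\<^sup>2 \<le> measure lebesgue (\<Union>n\<in>F. A n) * s2"
      unfolding s1_def s2_def by (rule chung_erdos[OF F(1)]) (simp add: A_def lmeasurable_reduced_nbhd)
    also have "measure lebesgue (\<Union>n\<in>F. A n) * s2 \<le> measure lebesgue (V N) * s2"
    proof (intro mult_right_mono measure_mono_fmeasurable)
      show "(\<Union>n\<in>F. A n) \<subseteq> V N" using F(2) by (auto simp: A_def V_def)
      show "(\<Union>n\<in>F. A n) \<in> sets lebesgue" using open_reduced_nbhd unfolding A_def by (intro sets.finite_UN F(1)) auto
      show "0 \<le> s2" unfolding s2_def by (intro sum_nonneg) auto
    qed (rule Vm)
    also have "s2 \<le> 10 * s\<^sup>2"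
    proof -
      have "s2 \<le> (\<Sum>m\<in>F. \<Sum>n\<in>F. 8 * f m * f n + (if m = n then 2 * f n else 0))"
        unfolding s2_def
      proof (intro sum_mono)
        fix m n assume mn: "m \<in> F" "n \<in> F"
        show "measure lebesgue (A m \<inter> A n) \<le> 8 * f m * f n + (if m = n then 2 * f n else 0)"
        proof (cases "m = n")
          case True
          have "8 * f n * f n \<ge> 0" using FG[OF mn(2)] by simp
          moreover have "measure lebesgue (A m \<inter> A n) \<le> 2 * f n" using upper[OF mn(2)] True by simp
          ultimately have "measure lebesgue (A m \<inter> A n) \<le> 8 * f m * f n + 2 * f n"
            unfolding True by linarith
          thus ?thesis using True by simp
        next
          case False
          thus ?thesis using measure_reduced_nbhd_overlap[OF FG(3)[OF mn(1)] FG(3)[OF mn(2)] False FG(1)[OF mn(1)] FG(1)[OF mn(2)]]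
            by (simp add: A_def)
        qed
      qed
      also have "\<dots> = 8 * s\<^sup>2 + 2 * s"
        using F(1) by (simp add: sum.distrib s_def power2_eq_square sum_product sum_distrib_left sum_distrib_right mult_ac)
      also have "\<dots> \<le> 10 * s\<^sup>2" using s mult_right_mono[of 1 s s] by (simp add: power2_eq_square)
      finally show ?thesis .
    qed
    hence "measure lebesgue (V N) * s2 \<le> measure lebesgue (V N) * (10 * s\<^sup>2)" by (intro mult_left_mono) auto
    finally have "(4 * c\<^sup>2) * s\<^sup>2 \<le> (10 * measure lebesgue (V N)) * s\<^sup>2" by (simp add: power2_eq_square mult_ac)
    hence "4 * c\<^sup>2 \<le> 10 * measure lebesgue (V N)" using s by (simp add: mult_le_cancel_right)
    thus ?thesis by simp
  qed
  have lim: "(\<lambda>N. measure lebesgue (V N)) \<longlonglongrightarrow> measure lebesgue (\<Inter>N. V N)"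
  proof (rule Lim_measure_decseq)
    show "range V \<subseteq> sets lebesgue" using Vm by auto
    show "decseq V" unfolding decseq_def V_def by auto
    show "emeasure lebesgue (V N) \<noteq> \<infinity>" for N using Vm[of N] by (auto simp: fmeasurable_def)
  qed
  show "measure lebesgue L \<ge> 2 * c\<^sup>2 / 5" unfolding LV by (intro LIMSEQ_le_const[OF lim]) (use V in auto)
qed

section \<open>A zero-one law for the doubling map\<close>

text \<open>Cover \<open>S\<close> by an open set of hardly larger measure and that in turn by almost disjoint dyadic
  intervals. If \<open>S\<close> missed the fraction \<open>e\<close> of every interval, then the open set would exceed \<open>S\<close> by too much.\<close>
lemma exists_dyadic_interval_of_high_density:
  fixes S :: "real set"
  assumes S: "S \<in> sets lebesgue" "S \<subseteq> {0..1}" and pos: "measure lebesgue S > 0" and e: "0 < e" "e < 1"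
  obtains u v n where "{u..v} \<subseteq> {0..1}" "v - u = 1 / 2 ^ n" "measure lebesgue ({u..v} - S) < e / 2 ^ n"
proof -
  define \<sigma> where "\<sigma> = measure lebesgue S"
  define \<delta> where "\<delta> = e / 3"
  have \<delta>: "\<delta> > 0" "\<sigma> > 0" using e pos by (auto simp: \<delta>_def \<sigma>_def)
  have lS: "S \<in> lmeasurable" using S by (meson bounded_closed_interval bounded_set_imp_lmeasurable bounded_subset)
  obtain U where U: "open U" "S \<subseteq> U" "U - S \<in> lmeasurable" "emeasure lebesgue (U - S) < ennreal (\<delta> * \<sigma>)"
    using sets_lebesgue_outer_open[OF S(1), of "\<delta> * \<sigma>"] \<delta> by auto
  have US: "measure lebesgue (U - S) < \<delta> * \<sigma>"
    using U(3,4) by (simp add: emeasure_eq_measure2 ennreal_less_iff)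
  define g where "g x = (if x \<in> U then U else UNIV)" for x
  have "gauge g" unfolding gauge_def g_def using U(1) by auto
  then obtain \<D> where D: "countable \<D>" "\<Union>\<D> \<subseteq> cbox 0 (1::real)"
    "\<And>K. K \<in> \<D> \<Longrightarrow> interior K \<noteq> {} \<and> (\<exists>c d. K = cbox c d)"
    "pairwise (\<lambda>A B. interior A \<inter> interior B = {}) \<D>"
    "\<And>K. K \<in> \<D> \<Longrightarrow> \<exists>x \<in> S \<inter> K. K \<subseteq> g x"
    "\<And>u v. cbox u v \<in> \<D> \<Longrightarrow> \<exists>n. \<forall>i \<in> Basis. v \<bullet> i - u \<bullet> i = (1 \<bullet> i - 0 \<bullet> i) / 2^n"
    "S \<subseteq> \<Union>\<D>"
    using covering_lemma[of S "0::real" 1 g] S(2) by (auto simp: cbox_interval)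
  have lD: "K \<in> lmeasurable" if "K \<in> \<D>" for K using D(3)[OF that] by auto
  have KU: "K \<subseteq> U" if "K \<in> \<D>" for K using D(5)[OF that] U(2) by (force simp: g_def)
  have bounded: "measure lebesgue (\<Union>\<D>') \<le> 1" if "\<D>' \<subseteq> \<D>" "finite \<D>'" for \<D>'
  proof -
    have "\<Union>\<D>' \<in> sets lebesgue" using that lD by (intro sets.finite_Union) (auto dest: fmeasurableD)
    moreover have "\<Union>\<D>' \<subseteq> {0..1}" using that(1) D(2) by (auto simp: cbox_interval)
    ultimately have "measure lebesgue (\<Union>\<D>') \<le> measure lebesgue {0..1::real}"
      by (intro measure_mono_fmeasurable) auto
    thus ?thesis by simp
  qed
  obtain \<D>' where D': "\<D>' \<subseteq> \<D>" "finite \<D>'" "measure lebesgue (\<Union>\<D>) - \<delta> * \<sigma> < measure lebesgue (\<Union>\<D>')"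
    using measure_countable_Union_approachable[OF D(1) mult_pos_pos[OF \<delta>] lD bounded] by blast
  have "(\<Union>\<D>) \<in> lmeasurable"
  proof (rule fmeasurableI2[of "{0..1::real}"])
    show "\<Union>\<D> \<in> sets lebesgue" using D(1) lD by (intro sets.countable_Union) (auto dest: fmeasurableD)
  qed (use D(2) in \<open>auto simp: cbox_interval\<close>)
  hence "\<sigma> \<le> measure lebesgue (\<Union>\<D>)" unfolding \<sigma>_def using D(7) S by (intro measure_mono_fmeasurable) auto
  hence mD': "\<sigma> - \<delta> * \<sigma> < measure lebesgue (\<Union>\<D>')" using D'(3) by linarith
  have "\<exists>K\<in>\<D>'. measure lebesgue (K - S) < e * measure lebesgue K"
  proof (rule ccontr)
    assume "\<not> ?thesis"
    hence *: "e * measure lebesgue K \<le> measure lebesgue (K - S)" if "K \<in> \<D>'" for K using that by force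
    have fr: "negligible (K \<inter> L)" if "K \<in> \<D>'" "L \<in> \<D>'" "K \<noteq> L" for K L
    proof -
      have "K \<in> \<D>" "L \<in> \<D>" using D'(1) that by auto
      then obtain a b c d where KL: "K = cbox a b" "L = cbox c d" using D(3) by meson
      have "interior K \<inter> interior L = {}" using D(4) D'(1) that by (auto simp: pairwise_def)
      moreover have "convex (K \<inter> L)" unfolding KL by (intro convex_Int convex_box)
      ultimately show ?thesis by (simp add: negligible_convex_interior)
    qed
    have "e * (\<sigma> - \<delta> * \<sigma>) \<le> e * measure lebesgue (\<Union>\<D>')" using mD' e by (intro mult_left_mono) auto
    also have "\<dots> \<le> e * (\<Sum>K\<in>\<D>'. measure lebesgue K)"
      using D' lD e by (intro mult_left_mono measure_Union_le) (auto simp: fmeasurableD)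
    also have "\<dots> \<le> (\<Sum>K\<in>\<D>'. measure lebesgue (K - S))"
      unfolding sum_distrib_left by (intro sum_mono *)
    also have "\<dots> = measure lebesgue (\<Union>K\<in>\<D>'. K - S)"
    proof (rule measure_negligible_finite_Union_image[symmetric])
      show "pairwise (\<lambda>K L. negligible ((K - S) \<inter> (L - S))) \<D>'"
        using fr by (auto simp: pairwise_def intro: negligible_subset)
    qed (use D' lD S in \<open>auto intro: fmeasurable_Diff\<close>)
    also have "\<dots> \<le> measure lebesgue (U - S)"
    proof (rule measure_mono_fmeasurable[OF _ _ U(3)])
      show "(\<Union>K\<in>\<D>'. K - S) \<subseteq> U - S" using D'(1) KU by blast
      show "(\<Union>K\<in>\<D>'. K - S) \<in> sets lebesgue"
        using D'(1) lD S(1) by (intro sets.finite_UN D'(2) sets.Diff) (auto dest: fmeasurableD)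
    qed
    finally have "e * (\<sigma> - \<delta> * \<sigma>) < \<delta> * \<sigma>" using US by linarith
    hence "\<sigma> * (e * (1 - \<delta>)) < \<sigma> * \<delta>" by (simp add: algebra_simps)
    hence "e * (1 - \<delta>) < \<delta>" using \<delta>(2) by simp
    hence "e * (1 - e / 3) < e * (1 / 3)" by (simp add: \<delta>_def)
    hence "1 - e / 3 < 1 / 3" using e(1) by (simp only: mult_less_cancel_left_pos)
    thus False using e(2) by linarith
  qed
  then obtain K where K: "K \<in> \<D>'" "measure lebesgue (K - S) < e * measure lebesgue K" by blast
  then obtain u v where uv: "K = cbox u v" using D(3) D'(1) by blast
  obtain n where n: "v - u = 1 / 2 ^ n" using D(6)[of u v] K(1) D'(1) uv by auto
  have "v - u > 0" unfolding n by simp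
  hence "u \<le> v" by simp
  hence "measure lebesgue K = 1 / 2 ^ n" using n uv by (simp add: cbox_interval)
  hence "measure lebesgue ({u..v} - S) < e / 2 ^ n" using K(2) uv by (simp add: cbox_interval)
  moreover have "K \<subseteq> cbox 0 1" using K(1) D'(1) D(2) by blast
  hence "{u..v} \<subseteq> {0..1}" unfolding uv by (simp add: cbox_interval)
  ultimately show ?thesis using that n by blast
qed

text \<open>Take an interval of length \<open>2\<^sup>-\<^sup>n\<close> of which \<open>E\<close> misses less than the fraction \<open>e\<close>. The map
  \<open>x \<mapsto> 2\<^sup>n x\<close> sends it to an interval of length one, and there the complement of \<open>E\<close> lies in
  the image of the missing part. By periodicity two integer translates of that image, each of measure below \<open>e\<close>,
  cover the complement of \<open>E\<close> in the unit interval.\<close>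
lemma doubling_zero_one_law:
  fixes E :: "real set"
  assumes E_borel: "E \<in> sets borel" and pos: "measure lebesgue (E \<inter> {0..1}) > 0"
    and double: "\<And>x. x \<in> E \<Longrightarrow> 2 * x \<in> E" and periodic: "\<And>x. x + 1 \<in> E \<longleftrightarrow> x \<in> E"
  shows "AE x in lebesgue. x \<in> E"
proof -
  have E: "E \<in> sets lebesgue" using E_borel by simp
  define N where "N = {0..1} - E"
  have periodic_nat: "x + real m \<in> E \<longleftrightarrow> x \<in> E" for x m
  proof (induction m)
    case (Suc m)
    thus ?case using periodic[of "x + real m"] by (simp add: add_ac)
  qed simp
  have periodic_int: "x + of_int m \<in> E \<longleftrightarrow> x \<in> E" for x m
  proof (cases "m \<ge> 0")
    case True
    thus ?thesis using periodic_nat[of x "nat m"] by simp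
  next
    case False
    thus ?thesis using periodic_nat[of "x + of_int m" "nat (- m)"] by simp
  qed
  have double_pow: "x \<in> E \<Longrightarrow> 2 ^ n * x \<in> E" for x n
  proof (induction n)
    case (Suc n)
    thus ?case using double[of "2 ^ n * x"] by (simp add: mult.assoc)
  qed simp
  have small: "measure lebesgue N \<le> 2 * e" if e: "0 < e" "e < 1" for e
  proof -
    obtain u v n where uv: "{u..v} \<subseteq> {0..1}" "v - u = 1 / 2 ^ n"
      "measure lebesgue ({u..v} - E \<inter> {0..1}) < e / 2 ^ n"
      by (rule exists_dyadic_interval_of_high_density[OF _ _ pos e]) (use E in auto)
    define Z where "Z = {u..v} - E \<inter> {0..1}"
    define T where "T m = (\<lambda>x. 2 ^ n *\<^sub>R x + (- of_int m :: real)) ` Z" for m :: int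
    have Zl: "Z \<in> lmeasurable" unfolding Z_def using E by (intro fmeasurable_Diff) auto
    have mT: "measure lebesgue (T m) < e" for m
    proof -
      have "measure lebesgue (T m) = 2 ^ n * measure lebesgue Z"
        unfolding T_def by (subst measure_lebesgue_affine) simp
      thus ?thesis using uv(3) by (simp add: Z_def field_simps)
    qed
    have Tl: "T m \<in> lmeasurable" for m
    proof -
      have "T m = (\<lambda>x. (x + of_int m) / 2 ^ n) -` Z \<inter> space borel"
        unfolding T_def by (auto simp: image_iff field_simps intro!: bexI[of _ "(_ + of_int m) / 2 ^ n"])
      also have "\<dots> \<in> sets borel"
      proof (rule measurable_sets[of _ borel borel])
        show "Z \<in> sets borel" unfolding Z_def using E_borel by (intro sets.Diff sets.Int) auto
      qed auto
      finally have "T m \<in> sets lebesgue" by simp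
      moreover have "emeasure lebesgue (T m) = ennreal (2 ^ n) * emeasure lebesgue Z"
        unfolding T_def by (subst emeasure_lebesgue_affine) simp
      ultimately show ?thesis using Zl
        by (auto simp: fmeasurable_def ennreal_mult_less_top)
    qed
    define w where "w = 2 ^ n * u"
    have wv: "2 ^ n * v = w + 1"
    proof -
      have "2 ^ n * (v - u) = 1" unfolding uv(2) by simp
      thus ?thesis by (simp add: w_def algebra_simps)
    qed
    have "N \<subseteq> T (\<lceil>w\<rceil> - 1) \<union> T \<lceil>w\<rceil>"
    proof
      fix x assume x: "x \<in> N"
      define m where "m = \<lceil>w - x\<rceil>"
      define y where "y = (x + of_int m) / 2 ^ n"
      have m: "w \<le> x + of_int m" "x + of_int m < w + 1" unfolding m_def by linarith+
      have yx: "2 ^ n * y = x + of_int m" by (simp add: y_def)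
      have "2 ^ n * u \<le> 2 ^ n * y" "2 ^ n * y \<le> 2 ^ n * v" unfolding yx wv using m w_def by auto
      hence "u \<le> y" "y \<le> v" by simp_all
      moreover have "y \<notin> E"
      proof
        assume "y \<in> E"
        hence "x + of_int m \<in> E" using double_pow[of y n] yx by simp
        thus False using x periodic_int by (auto simp: N_def)
      qed
      ultimately have "y \<in> Z" by (auto simp: Z_def)
      hence "x \<in> T m" unfolding T_def using yx by (intro image_eqI[of _ _ y]) auto
      moreover have "m = \<lceil>w\<rceil> - 1 \<or> m = \<lceil>w\<rceil>" using x unfolding m_def N_def by simp linarith
      ultimately show "x \<in> T (\<lceil>w\<rceil> - 1) \<union> T \<lceil>w\<rceil>" by blast
    qed
    hence "measure lebesgue N \<le> measure lebesgue (T (\<lceil>w\<rceil> - 1) \<union> T \<lceil>w\<rceil>)"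
      using Tl E by (intro measure_mono_fmeasurable) (auto simp: N_def)
    also have "\<dots> \<le> measure lebesgue (T (\<lceil>w\<rceil> - 1)) + measure lebesgue (T \<lceil>w\<rceil>)"
      using Tl by (intro measure_Un_le) auto
    also have "\<dots> \<le> 2 * e" using mT[of "\<lceil>w\<rceil>"] mT[of "\<lceil>w\<rceil> - 1"] by simp
    finally show ?thesis .
  qed
  have "measure lebesgue N \<le> 0"
  proof (rule field_le_epsilon)
    fix d :: real assume "d > 0"
    hence "measure lebesgue N \<le> 2 * min (d / 2) (1 / 2)" by (intro small) auto
    also have "\<dots> \<le> 2 * (d / 2)" by (intro mult_left_mono min.cobounded1) simp
    finally show "measure lebesgue N \<le> 0 + d" by simp
  qed
  moreover have "N \<in> lmeasurable" unfolding N_def using E by (intro fmeasurable_Diff) auto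
  ultimately have "negligible N"
    by (simp add: negligible_iff_measure antisym)
  hence neg: "negligible (\<Union>m::int. (+) (of_int m) ` N)"
    by (intro negligible_countable_Union) (auto intro: negligible_translation)
  have "- E \<subseteq> (\<Union>m::int. (+) (of_int m) ` N)"
  proof
    fix x assume "x \<in> - E"
    hence "frac x \<notin> E" using periodic_int[of "frac x" "\<lfloor>x\<rfloor>"] by (simp add: frac_def)
    moreover have "frac x \<in> {0..1}" using frac_lt_1[of x] by simp
    ultimately have "frac x \<in> N" by (simp add: N_def)
    moreover have "x = of_int \<lfloor>x\<rfloor> + frac x" by (simp add: frac_def)
    ultimately show "x \<in> (\<Union>m::int. (+) (of_int m) ` N)" by blast
  qed
  hence "negligible (- E)" using neg negligible_subset by blast
  thus ?thesis by (intro AE_I'[of "- E"]) (auto simp: negligible_iff_null_sets)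
qed

section \<open>Dyadic scales\<close>

text \<open>Take the last \<open>q\<^sub>l\<close> before the squares of the denominators exceed \<open>2\<^sup>k\<close>. Then
  \<open>2\<^sup>k < q\<^sub>l\<^sub>+\<^sub>1\<^sup>2 \<le> 4 q\<^sub>l\<^sup>6 \<le> q\<^sub>l\<^sup>7\<close>.\<close>
lemma eventually_reduced_fraction_of_intermediate_denominator:
  assumes irr: "\<alpha> \<notin> \<rat>"
    and growth: "eventually (\<lambda>l. convergent_denom \<alpha> (Suc l) \<le> 2 * convergent_denom \<alpha> l ^ 3) sequentially"
  shows "eventually (\<lambda>k. \<exists>p q. q > 0 \<and> coprime p (int q) \<and> \<bar>\<alpha> - of_int p / real q\<bar> \<le> 1 / real q ^ 2
                          \<and> q ^ 2 \<le> 2 ^ k \<and> 2 ^ k \<le> q ^ 7) sequentially"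
proof -
  define Q where "Q = convergent_denom \<alpha>"
  obtain l0 where l0: "Q (Suc l) \<le> 2 * Q l ^ 3" if "l \<ge> l0" for l
    using growth unfolding eventually_sequentially Q_def by blast
  define l1 where "l1 = max l0 4"
  define k0 where "k0 = Max ((\<lambda>l. Q l ^ 2) ` {..l1})"
  have "\<exists>p q. q > 0 \<and> coprime p (int q) \<and> \<bar>\<alpha> - of_int p / real q\<bar> \<le> 1 / real q ^ 2
                          \<and> q ^ 2 \<le> 2 ^ k \<and> 2 ^ k \<le> q ^ 7" if k: "k \<ge> k0" for k
  proof -
    have k2: "k < 2 ^ k" by (rule less_exp)
    define L where "L = (LEAST l. Q l ^ 2 > 2 ^ k)"
    have "(2::nat) ^ k < (2 ^ k + 1) ^ 2" by (simp add: power2_eq_square)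
    also have "\<dots> \<le> Q (2 ^ k + 1) ^ 2"
      using convergent_denom_ge[OF irr, of "2 ^ k + 1"] unfolding Q_def by (intro power_mono) auto
    finally have ex: "2 ^ k < Q (2 ^ k + 1) ^ 2" .
    have L: "Q L ^ 2 > 2 ^ k" unfolding L_def by (rule LeastI[of "\<lambda>l. Q l ^ 2 > 2 ^ k", OF ex])
    have "L > l1"
    proof (rule ccontr)
      assume "\<not> L > l1"
      hence "Q L ^ 2 \<le> k0" unfolding k0_def by (intro Max_ge) auto
      thus False using L k k2 by linarith
    qed
    then obtain l where l: "L = Suc l" "l \<ge> l1" by (cases L) auto
    have lk: "Q l ^ 2 \<le> 2 ^ k" using not_less_Least[of l "\<lambda>l. Q l ^ 2 > 2 ^ k"] l unfolding L_def by simp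
    have Q4: "Q l \<ge> 4" using convergent_denom_ge[OF irr, of l] l unfolding Q_def l1_def by linarith
    have "2 ^ k < Q (Suc l) ^ 2" using L l by simp
    also have "\<dots> \<le> (2 * Q l ^ 3) ^ 2" using l0[of l] l by (intro power_mono) (auto simp: l1_def)
    also have "\<dots> = 4 * Q l ^ 6" by (simp add: power_mult_distrib flip: power_mult)
    also have "\<dots> \<le> Q l * Q l ^ 6" using Q4 by (intro mult_right_mono) auto
    also have "\<dots> = Q l ^ 7" by (simp add: eval_nat_numeral)
    finally have up: "2 ^ k \<le> Q l ^ 7" by simp
    have "Q l ^ 2 < Q (Suc l) ^ 2" using lk L l by simp
    hence QQ: "Q l < Q (Suc l)" by (rule power_less_imp_less_base) simp
    define p where "p = convergent_num \<alpha> l"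
    have "\<bar>real (Q l) * \<alpha> - of_int p\<bar> * real (Q l) \<le> \<bar>real (Q l) * \<alpha> - of_int p\<bar> * real (Q (Suc l))"
      using QQ by (intro mult_left_mono) auto
    also have "\<dots> \<le> 1" using convergent_error_bound[OF irr, of l] by (simp add: Q_def p_def)
    finally have e: "\<bar>real (Q l) * \<alpha> - of_int p\<bar> * real (Q l) \<le> 1" .
    have "real (Q l) * \<alpha> - of_int p = real (Q l) * (\<alpha> - of_int p / real (Q l))" using Q4 by (simp add: field_simps)
    hence "\<bar>real (Q l) * \<alpha> - of_int p\<bar> = real (Q l) * \<bar>\<alpha> - of_int p / real (Q l)\<bar>" by (simp add: abs_mult)
    hence "\<bar>\<alpha> - of_int p / real (Q l)\<bar> * real (Q l) ^ 2 \<le> 1" using e by (simp add: power2_eq_square mult_ac)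
    hence "\<bar>\<alpha> - of_int p / real (Q l)\<bar> \<le> 1 / real (Q l) ^ 2" using Q4 by (simp add: field_simps)
    moreover have "coprime p (int (Q l))" unfolding p_def Q_def by (rule coprime_convergent[OF irr])
    ultimately show ?thesis using Q4 lk up by (intro exI[of _ p] exI[of _ "Q l"]) auto
  qed
  thus ?thesis unfolding eventually_sequentially by blast
qed

text \<open>The outcome of the counting part in the only form in which it enters the metric part; it
  involves \<open>\<alpha>\<close> but not \<open>\<psi>\<close>.\<close>
definition equidistributed_scale :: "real \<Rightarrow> nat \<Rightarrow> bool" where
  "equidistributed_scale \<alpha> k \<longleftrightarrow> (\<forall>j\<in>{1..k div 14}.
     real (card {n\<in>{2 ^ k..<2 * 2 ^ k}. dist_nearest_int (real n * \<alpha>) \<le> (1 / 2) ^ j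
                        \<and> exp (-98) * real n \<le> real (totient n)}) \<ge> 2 ^ k * (1 / 2) ^ j / 4)"

text \<open>With \<open>q\<^sup>2 \<le> 2\<^sup>k \<le> q\<^sup>7\<close> and \<open>j \<le> k/14\<close> one has \<open>2\<^sup>j \<le> \<surd>q\<close>, which leaves room for the
  polynomial factors in \<open>k\<close> that the counting lemma demands.\<close>
lemma eventually_equidistributed_scale:
  assumes irr: "\<alpha> \<notin> \<rat>"
    and growth: "eventually (\<lambda>l. convergent_denom \<alpha> (Suc l) \<le> 2 * convergent_denom \<alpha> l ^ 3) sequentially"
  shows "eventually (equidistributed_scale \<alpha>) sequentially"
proof -
  have "eventually (\<lambda>k::nat. (2 * real k ^ 2) ^ 14 \<le> 2 ^ k) sequentially" by real_asymp
  moreover have "eventually (\<lambda>k::nat. real k ^ 2 \<le> 2 ^ k) sequentially" by real_asymp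
  moreover note eventually_reduced_fraction_of_intermediate_denominator[OF assms] eventually_ge_at_top[of 2]
  ultimately show ?thesis
  proof eventually_elim
    case (elim k)
    then obtain p q where q: "q > 0" "coprime p (int q)" "\<bar>\<alpha> - of_int p / real q\<bar> \<le> 1 / real q ^ 2"
      "q ^ 2 \<le> 2 ^ k" "2 ^ k \<le> q ^ 7" by blast
    have "(k * q) ^ 2 \<le> (2 ^ k) ^ 2"
    proof -
      have "k ^ 2 \<le> 2 ^ k" using elim(2) by (metis of_nat_le_iff of_nat_numeral of_nat_power)
      hence "k ^ 2 * q ^ 2 \<le> 2 ^ k * 2 ^ k" using q(4) by (intro mult_mono) auto
      thus ?thesis by (simp add: power2_eq_square mult_ac)
    qed
    hence kq: "k * q \<le> 2 ^ k" by (rule power2_le_imp_le) simp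
    have "2 ^ k * (1 / 2) ^ j / 4 \<le> real (card {n\<in>{2 ^ k..<2 * 2 ^ k}. dist_nearest_int (real n * \<alpha>) \<le> (1 / 2) ^ j
                        \<and> exp (-98) * real n \<le> real (totient n)})" if j: "j \<in> {1..k div 14}" for j
    proof (rule card_near_int_large_totient_ge[OF q(2,1,3) _ _ _ kq])
      show "(1 / 2 :: real) ^ j \<le> 1 / 2" using j power_decreasing[of 1 j "1 / 2 :: real"] by simp
      have "14 * j \<le> k" using j by auto
      have "(2 * real k ^ 2 * 2 ^ j) ^ 14 = (2 * real k ^ 2) ^ 14 * 2 ^ (14 * j)"
        by (simp add: power_mult_distrib mult.commute flip: power_mult)
      also have "\<dots> \<le> 2 ^ k * 2 ^ k"
        using elim(1) \<open>14 * j \<le> k\<close> by (intro mult_mono power_increasing) auto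
      also have "\<dots> \<le> real q ^ 7 * real q ^ 7"
      proof -
        have "(2::real) ^ k \<le> real q ^ 7" using q(5) by (metis of_nat_le_iff of_nat_numeral of_nat_power)
        thus ?thesis by (intro mult_mono) auto
      qed
      also have "\<dots> = real q ^ 14" by (simp flip: power_add)
      finally have "2 * real k ^ 2 * 2 ^ j \<le> real q" by (rule power_le_imp_le_base[where n = 13, simplified]) simp
      thus "2 * real k ^ 2 \<le> real q * (1 / 2) ^ j" by (simp add: power_one_over field_simps)
    qed (use elim in auto)
    thus ?case unfolding equidistributed_scale_def by blast
  qed
qed

text \<open>A substitute for \<open>1/x\<close> (up to a constant factor), truncated at \<open>2\<^sup>J\<close>. As a sum over
  scales it can be summed over \<open>n\<close> with the counts for \<open>\<parallel>n \<alpha>\<parallel> \<le> 2\<^sup>-\<^sup>j\<close> alone.\<close>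
definition dyadic_weight :: "nat \<Rightarrow> real \<Rightarrow> real" where
  "dyadic_weight J x = (\<Sum>j=1..J. if x \<le> (1 / 2) ^ j then 2 ^ (j - 1) else 0)"

lemma dyadic_weight_bounds:
  assumes "x \<ge> 0"
  shows "0 \<le> dyadic_weight J x" "dyadic_weight J x \<le> 2 ^ J - 1" "dyadic_weight J x * x < 1"
proof -
  show "0 \<le> dyadic_weight J x" unfolding dyadic_weight_def by (intro sum_nonneg) auto
  have "dyadic_weight J x \<le> 2 ^ J - 1 \<and> dyadic_weight J x * x < 1"
  proof (induction J)
    case (Suc J)
    have S: "dyadic_weight (Suc J) x = dyadic_weight J x + (if x \<le> (1 / 2) ^ Suc J then 2 ^ J else 0)"
      by (simp add: dyadic_weight_def)
    show ?case
    proof (cases "x \<le> (1 / 2) ^ Suc J")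
      case True
      have le: "dyadic_weight (Suc J) x \<le> 2 ^ Suc J - 1" using S True Suc.IH by simp
      have "(1::real) \<le> 2 ^ Suc J" by (rule one_le_power) simp
      with le have "dyadic_weight (Suc J) x * x \<le> (2 ^ Suc J - 1) * (1 / 2) ^ Suc J"
        using True assms by (intro mult_mono) (simp_all del: power_Suc)
      also have "\<dots> = 1 - (1 / 2) ^ Suc J" by (simp add: left_diff_distrib power_one_over field_simps)
      also have "\<dots> < 1" by simp
      finally show ?thesis using le by blast
    next
      case False
      have eq: "dyadic_weight (Suc J) x = dyadic_weight J x" using S False by simp
      have "(2::real) ^ J \<le> 2 ^ Suc J" by simp
      thus ?thesis unfolding eq using conjunct1[OF Suc.IH] conjunct2[OF Suc.IH] by (intro conjI) linarith+
    qed
  qed (simp add: dyadic_weight_def)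
  thus "dyadic_weight J x \<le> 2 ^ J - 1" "dyadic_weight J x * x < 1" by auto
qed

lemma sum_dyadic_weight_ge:
  assumes "equidistributed_scale \<alpha> k"
  shows "(\<Sum>n\<in>{n\<in>{2 ^ k..<2 * 2 ^ k}. exp (-98) * real n \<le> real (totient n)}.
            dyadic_weight (k div 14) (dist_nearest_int (real n * \<alpha>))) \<ge> real (k div 14) * 2 ^ k / 8"
    (is "sum ?w ?G \<ge> _")
proof -
  have "real (k div 14) * 2 ^ k / 8 = (\<Sum>j=1..k div 14. 2 ^ k / 8)" by simp
  also have "\<dots> \<le> (\<Sum>j=1..k div 14. \<Sum>n\<in>?G. if dist_nearest_int (real n * \<alpha>) \<le> (1 / 2) ^ j then 2 ^ (j - 1) else 0)"
  proof (intro sum_mono)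
    fix j assume j: "j \<in> {1..k div 14}"
    let ?B = "{n\<in>{2 ^ k..<2 * 2 ^ k}. dist_nearest_int (real n * \<alpha>) \<le> (1 / 2) ^ j
                        \<and> exp (-98) * real n \<le> real (totient n)}"
    have "2 ^ k * (1 / 2) ^ j / 4 \<le> real (card ?B)"
      using assms j unfolding equidistributed_scale_def by blast
    hence "2 ^ (j - 1) * (2 ^ k * (1 / 2) ^ j / 4) \<le> 2 ^ (j - 1) * real (card ?B)"
      by (intro mult_left_mono) auto
    moreover have "(2::real) ^ (j - 1) * (2 ^ k * (1 / 2) ^ j / 4) = 2 ^ k / 8"
    proof -
      obtain i where "j = Suc i" using j by (cases j) auto
      thus ?thesis by (simp add: power_one_over)
    qed
    moreover have "?G \<inter> {n. dist_nearest_int (real n * \<alpha>) \<le> (1 / 2) ^ j} = ?B" by auto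
    hence "(\<Sum>n\<in>?G. if dist_nearest_int (real n * \<alpha>) \<le> (1 / 2) ^ j then (2::real) ^ (j - 1) else 0)
        = 2 ^ (j - 1) * real (card ?B)"
      by (subst sum.inter_restrict[symmetric, where B = "{n. dist_nearest_int (real n * \<alpha>) \<le> (1 / 2) ^ j}", simplified]) auto
    ultimately show "(2::real) ^ k / 8 \<le> (\<Sum>n\<in>?G. if dist_nearest_int (real n * \<alpha>) \<le> (1 / 2) ^ j then 2 ^ (j - 1) else 0)"
      by linarith
  qed
  also have "\<dots> = sum ?w ?G" unfolding dyadic_weight_def by (rule sum.swap)
  finally show ?thesis .
qed

text \<open>Cauchy condensation: by monotonicity the block \<open>[2\<^sup>k\<^sup>+\<^sup>1, 2\<^sup>k\<^sup>+\<^sup>2)\<close> contributes at most \<open>6 k 2\<^sup>k \<psi> (2\<^sup>k\<^sup>+\<^sup>1)\<close> to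
  the original series. Truncating \<open>\<psi>\<close> at \<open>2\<^sup>-\<^sup>k\<close> caps the \<open>k\<close>th term at \<open>k\<close>, so if the truncated
  series converged, only finitely many terms would be affected.\<close>
lemma not_summable_truncated_dyadic_blocks:
  fixes \<psi> :: "nat \<Rightarrow> real"
  assumes pos: "\<And>n. n \<ge> 1 \<Longrightarrow> \<psi> n > 0" and anti: "antimono_on {1..} \<psi>"
    and div: "\<not> summable (\<lambda>n. \<psi> (Suc n) * ln (real (Suc n)))"
  shows "\<not> summable (\<lambda>k. real k * 2 ^ k * min (\<psi> (2 ^ Suc k)) ((1 / 2) ^ k))"
proof
  define a where "a k = real k * 2 ^ k * \<psi> (2 ^ Suc k)" for k
  assume summ: "summable (\<lambda>k. real k * 2 ^ k * min (\<psi> (2 ^ Suc k)) ((1 / 2) ^ k))"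
  have "eventually (\<lambda>k. real k * 2 ^ k * min (\<psi> (2 ^ Suc k)) ((1 / 2) ^ k) < 1) sequentially"
    using summable_LIMSEQ_zero[OF summ] by (rule order_tendstoD) simp
  hence "eventually (\<lambda>k. real k * 2 ^ k * min (\<psi> (2 ^ Suc k)) ((1 / 2) ^ k) = a k) sequentially"
    using eventually_ge_at_top[of 1]
  proof eventually_elim
    case (elim k)
    have k: "real k * 2 ^ k * (1 / 2) ^ k \<ge> 1" using elim(2) by (simp add: power_one_over)
    have "\<psi> (2 ^ Suc k) \<le> (1 / 2) ^ k"
    proof (rule ccontr)
      assume "\<not> ?thesis"
      hence "min (\<psi> (2 ^ Suc k)) ((1 / 2) ^ k) = (1 / 2) ^ k" by (simp add: min_def)
      thus False using elim(1) k by simp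
    qed
    thus ?case by (simp add: a_def)
  qed
  hence suma: "summable a" using summ summable_cong by fastforce
  have a0: "a k \<ge> 0" for k using pos[of "2 ^ Suc k"] by (simp add: a_def less_imp_le)
  define t where "t m = \<psi> m * ln (real m)" for m
  have t0: "t m \<ge> 0" if "m \<ge> 1" for m using pos[OF that] that by (simp add: t_def less_imp_le)
  have block: "(\<Sum>m\<in>{2 ^ Suc M..<2 ^ Suc (Suc M)}. t m) \<le> 6 * a M" if M: "M \<ge> 1" for M
  proof -
    have "(\<Sum>m\<in>{2 ^ Suc M..<2 ^ Suc (Suc M)}. t m) \<le> (\<Sum>m\<in>{2 ^ Suc M..<2 ^ Suc (Suc M) :: nat}. \<psi> (2 ^ Suc M) * (3 * real M))"
    proof (intro sum_mono)
      fix m :: nat assume m: "m \<in> {2 ^ Suc M..<2 ^ Suc (Suc M)}"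
      have m1: "m \<ge> 1" using m one_le_power[of "2::nat" "Suc M"] by (meson atLeastLessThan_iff le_trans one_le_numeral)
      have "\<psi> m \<le> \<psi> (2 ^ Suc M)" using m m1 by (intro monotone_onD[OF anti]) auto
      moreover have "ln (real m) \<le> 3 * real M"
      proof -
        have "ln (real m) \<le> ln (2 ^ Suc (Suc M))"
        proof (subst ln_le_cancel_iff)
          have "real m < real (2 ^ Suc (Suc M))" using m unfolding of_nat_less_iff by auto
          thus "real m \<le> 2 ^ Suc (Suc M)" by simp
        qed (use m1 in auto)
        also have "\<dots> = real (Suc (Suc M)) * ln 2" by (rule ln_realpow)
        also have "\<dots> \<le> real (Suc (Suc M)) * 1" using ln_2_less_1 by (intro mult_left_mono) auto
        also have "\<dots> \<le> 3 * real M" using M by simp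
        finally show ?thesis .
      qed
      ultimately show "t m \<le> \<psi> (2 ^ Suc M) * (3 * real M)"
        unfolding t_def using m1 pos[of "2 ^ Suc M"] by (intro mult_mono) auto
    qed
    also have "\<dots> = 6 * a M" by (simp add: a_def of_nat_diff)
    finally show ?thesis .
  qed
  have bound: "(\<Sum>m\<in>{1..<2 ^ Suc M}. t m) \<le> (\<Sum>m\<in>{1..<4}. t m) + (\<Sum>k<M. 6 * a k)" for M
  proof (induction M)
    case 0
    show ?case using t0 by (simp, intro sum_mono2) auto
  next
    case (Suc M)
    show ?case
    proof (cases "M = 0")
      case True
      thus ?thesis using a0[of 0] by simp
    next
      case False
      have "{1..<2 ^ Suc (Suc M)} = {1..<2 ^ Suc M} \<union> {2 ^ Suc M..<(2::nat) ^ Suc (Suc M)}"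
        by (intro ivl_disj_un_two(3)[symmetric]) auto
      hence "(\<Sum>m\<in>{1..<2 ^ Suc (Suc M)}. t m)
          = (\<Sum>m\<in>{1..<2 ^ Suc M}. t m) + (\<Sum>m\<in>{2 ^ Suc M..<2 ^ Suc (Suc M)}. t m)"
        by (simp add: sum.union_disjoint ivl_disj_int del: power_Suc)
      also have "\<dots> \<le> ((\<Sum>m\<in>{1..<4}. t m) + (\<Sum>k<M. 6 * a k)) + 6 * a M"
        using False by (intro add_mono Suc.IH block) auto
      finally show ?thesis by simp
    qed
  qed
  have "summable (\<lambda>n. t (Suc n))"
  proof (rule summableI_nonneg_bounded)
    fix N
    have "(\<Sum>n<N. t (Suc n)) = (\<Sum>m\<in>{1..<Suc N}. t m)"
      by (rule sum.reindex_bij_witness[of _ "\<lambda>m. m - 1" Suc]) auto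
    also have "\<dots> \<le> (\<Sum>m\<in>{1..<2 ^ Suc N}. t m)"
    proof (intro sum_mono2)
      have "Suc N \<le> 2 ^ Suc N" by (rule less_imp_le[OF less_exp])
      thus "{1..<Suc N} \<subseteq> {1..<2 ^ Suc N}" by auto
    qed (use t0 in auto)
    also have "\<dots> \<le> (\<Sum>m\<in>{1..<4}. t m) + (\<Sum>k<N. 6 * a k)" by (rule bound)
    also have "(\<Sum>k<N. 6 * a k) \<le> (\<Sum>k. 6 * a k)" using suma a0 by (intro sum_le_suminf) (auto intro: summable_mult)
    finally show "(\<Sum>n<N. t (Suc n)) \<le> (\<Sum>m\<in>{1..<4}. t m) + (\<Sum>k. 6 * a k)" by simp
  qed (use t0 in auto)
  thus False using div by (simp add: t_def)
qed

section \<open>From positive measure to full measure\<close>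

text \<open>Apply the limsup estimate to \<open>f n = h k w\<close>, where \<open>2\<^sup>k \<le> n < 2\<^sup>k\<^sup>+\<^sup>1\<close>, \<open>h k\<close> is the truncation of
  \<open>\<psi> (2\<^sup>k\<^sup>+\<^sup>1)\<close> and \<open>w\<close> is the dyadic weight of \<open>\<parallel>n \<alpha>\<parallel>\<close>. Since \<open>w \<parallel>n \<alpha>\<parallel> < 1\<close>, \<open>\<parallel>n \<beta>\<parallel> < f n\<close> implies
  \<open>\<parallel>n \<alpha>\<parallel> \<parallel>n \<beta>\<parallel> < h k \<le> \<psi> n\<close>. The truncation ensures \<open>f n \<le> 1/2\<close>. It is essential that the lower bound
  for the measure is an absolute constant.\<close>
lemma measure_fibre_ge:
  fixes \<alpha> :: real and \<psi> :: "nat \<Rightarrow> real"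
  assumes pos: "\<And>n. n \<ge> 1 \<Longrightarrow> \<psi> n > 0" and anti: "antimono_on {1..} \<psi>"
    and div: "\<not> summable (\<lambda>n. \<psi> (Suc n) * ln (real (Suc n)))"
    and equi: "eventually (equidistributed_scale \<alpha>) sequentially"
  obtains L where "L \<in> sets borel" "L \<subseteq> {0..1}" "measure lebesgue L \<ge> 2 * (exp (-98))\<^sup>2 / 5"
    "L \<subseteq> {\<beta>. infinite {n. n \<ge> 1 \<and> dist_nearest_int (real n * \<alpha>) * dist_nearest_int (real n * \<beta>) < \<psi> n}}"
proof -
  define h where "h k = min (\<psi> (2 ^ Suc k)) ((1 / 2) ^ k)" for k
  define w where "w n = dyadic_weight (floor_log n div 14) (dist_nearest_int (real n * \<alpha>))" for n
  define f where "f n = h (floor_log n) * w n" for n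
  define G :: "nat set" where "G = {n. n \<ge> 2 \<and> exp (-98) * real n \<le> real (totient n)}"
  define L where "L = {x. \<exists>\<^sub>\<infinity>n. n \<in> G \<and> x \<in> reduced_nbhd n (f n)}"
  have h: "0 < h k" "h k \<le> (1 / 2) ^ k" "h k \<le> \<psi> (2 ^ Suc k)" for k using pos[of "2 ^ Suc k"] by (auto simp: h_def)
  have w: "0 \<le> w n" "w n \<le> 2 ^ (floor_log n div 14)" "w n * dist_nearest_int (real n * \<alpha>) < 1" for n
  proof -
    note dyadic_weight_bounds[OF dist_nearest_int_nonneg, of "floor_log n div 14" "real n * \<alpha>", folded w_def]
    thus "0 \<le> w n" "w n \<le> 2 ^ (floor_log n div 14)" "w n * dist_nearest_int (real n * \<alpha>) < 1"
      by linarith+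
  qed
  have f: "0 \<le> f n \<and> f n \<le> 1 / 2" if "n \<in> G" for n
  proof -
    define k where "k = floor_log n"
    have "k \<ge> 1" using that floor_log_le_iff[of 2 n] floor_log_power[of 1] by (simp add: k_def G_def)
    hence "Suc (k div 14) \<le> k" by linarith
    have "f n \<le> (1 / 2) ^ k * 2 ^ (k div 14)"
      unfolding f_def k_def using h(1,2)[of "floor_log n"] w(1,2)[of n] by (intro mult_mono) auto
    also have "\<dots> \<le> (1 / 2) ^ Suc (k div 14) * 2 ^ (k div 14)"
      using \<open>Suc (k div 14) \<le> k\<close> by (intro mult_right_mono power_decreasing) auto
    also have "\<dots> = 1 / 2" by (simp add: power_one_over)
    finally show ?thesis using h(1)[of "floor_log n"] w(1)[of n] by (simp add: f_def)
  qed
  have div': "\<exists>F. finite F \<and> F \<subseteq> G \<inter> {N..} \<and> (\<Sum>n\<in>F. f n) \<ge> 1" for N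
  proof -
    define b where "b k = real k * 2 ^ k * h k" for k
    define Gk where "Gk k = {n\<in>{2 ^ k..<2 * 2 ^ k}. exp (-98) * real n \<le> real (totient n)}" for k :: nat
    have b0: "b k \<ge> 0" for k using h(1)[of k] by (simp add: b_def)
    have nb: "\<not> summable b"
      using not_summable_truncated_dyadic_blocks[OF pos anti div] by (simp add: b_def[abs_def] h_def)
    obtain K0 where K0: "equidistributed_scale \<alpha> k" if "k \<ge> K0" for k
      using equi unfolding eventually_sequentially by blast
    define K where "K = max K0 (max N 28)"
    have "\<not> summable (\<lambda>k. b (k + K))" using nb by (simp add: summable_iff_shift)
    hence "\<exists>M. (\<Sum>k<M. b (k + K)) > 224"
      using summableI_nonneg_bounded[of "\<lambda>k. b (k + K)" 224] b0 by (meson not_le)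
    then obtain M where M: "(\<Sum>k<M. b (k + K)) > 224" by blast
    define F where "F = (\<Union>k<M. Gk (k + K))"
    have fl: "floor_log n = k" if "n \<in> Gk k" for n k
      using that by (intro floor_log_eqI) (auto simp: Gk_def intro: less_le_trans[of 0 "2 ^ k"])
    have fin: "finite (Gk k)" for k by (simp add: Gk_def)
    \<comment> \<open>224 = 8 * 28: the weights of a block add up to \<open>(k div 14) 2\<^sup>k / 8\<close>, and \<open>k \<le> 28 (k div 14)\<close>\<close>
    have blk: "b k / 224 \<le> (\<Sum>n\<in>Gk k. f n)" if "k \<ge> K" for k
    proof -
      have "k \<ge> 28" "k \<ge> K0" using that by (auto simp: K_def)
      have "k \<le> 28 * (k div 14)" using \<open>k \<ge> 28\<close> by linarith
      hence "real k \<le> 28 * real (k div 14)" by (metis of_nat_le_iff of_nat_mult of_nat_numeral)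
      hence "real k * (2 ^ k * h k) \<le> 28 * real (k div 14) * (2 ^ k * h k)"
        using h(1)[of k] by (intro mult_right_mono) auto
      hence "b k / 224 \<le> h k * (real (k div 14) * 2 ^ k / 8)" by (simp add: b_def field_simps)
      also have "\<dots> \<le> h k * (\<Sum>n\<in>Gk k. dyadic_weight (k div 14) (dist_nearest_int (real n * \<alpha>)))"
        using sum_dyadic_weight_ge[OF K0[OF \<open>k \<ge> K0\<close>]] h(1)[of k] unfolding Gk_def by (intro mult_left_mono) auto
      also have "\<dots> = (\<Sum>n\<in>Gk k. f n)" unfolding sum_distrib_left by (intro sum.cong refl) (simp add: f_def w_def fl)
      finally show ?thesis .
    qed
    have "1 \<le> (\<Sum>k<M. b (k + K)) / 224" using M by simp
    also have "\<dots> = (\<Sum>k<M. b (k + K) / 224)" by (simp add: sum_divide_distrib)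
    also have "\<dots> \<le> (\<Sum>k<M. \<Sum>n\<in>Gk (k + K). f n)" by (intro sum_mono blk) auto
    also have "\<dots> = (\<Sum>n\<in>F. f n)" unfolding F_def
    proof (rule sum.UNION_disjoint[symmetric])
      show "\<forall>i\<in>{..<M}. \<forall>j\<in>{..<M}. i \<noteq> j \<longrightarrow> Gk (i + K) \<inter> Gk (j + K) = {}"
        using fl by (metis add_right_cancel disjoint_iff)
    qed (use fin in auto)
    finally have "1 \<le> (\<Sum>n\<in>F. f n)" .
    moreover have "F \<subseteq> G \<inter> {N..}"
    proof
      fix n assume "n \<in> F"
      then obtain k where k: "n \<in> Gk (k + K)" by (auto simp: F_def)
      have "K < 2 ^ K" by (rule less_exp)
      also have "(2::nat) ^ K \<le> 2 ^ (k + K)" by (intro power_increasing) auto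
      also have "\<dots> \<le> n" using k by (simp add: Gk_def)
      finally show "n \<in> G \<inter> {N..}" using k by (auto simp: G_def Gk_def K_def)
    qed
    moreover have "finite F" using fin by (auto simp: F_def)
    ultimately show ?thesis by blast
  qed
  note limsup = measure_limsup_reduced_nbhd_ge[of "exp (-98)" G f, OF _ f _ div', folded L_def]
  have "L \<in> sets borel" "L \<subseteq> {0..1}" "measure lebesgue L \<ge> 2 * (exp (-98))\<^sup>2 / 5"
    by (rule limsup; simp add: G_def)+
  moreover have "L \<subseteq> {\<beta>. infinite {n. n \<ge> 1 \<and> dist_nearest_int (real n * \<alpha>) * dist_nearest_int (real n * \<beta>) < \<psi> n}}"
  proof
    fix \<beta> assume "\<beta> \<in> L"
    hence "infinite {n. n \<in> G \<and> \<beta> \<in> reduced_nbhd n (f n)}" by (simp add: L_def frequently_cofinite)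
    moreover have "{n. n \<in> G \<and> \<beta> \<in> reduced_nbhd n (f n)}
       \<subseteq> {n. n \<ge> 1 \<and> dist_nearest_int (real n * \<alpha>) * dist_nearest_int (real n * \<beta>) < \<psi> n}"
    proof safe
      fix n assume n: "n \<in> G" "\<beta> \<in> reduced_nbhd n (f n)"
      define k where "k = floor_log n"
      show n1: "1 \<le> n" using n by (simp add: G_def)
      have "dist_nearest_int (real n * \<alpha>) * dist_nearest_int (real n * \<beta>) \<le> dist_nearest_int (real n * \<alpha>) * f n"
        using reduced_nbhdD[OF n(2)] dist_nearest_int_nonneg by (intro mult_left_mono) auto
      also have "\<dots> = h k * (w n * dist_nearest_int (real n * \<alpha>))" by (simp add: f_def k_def)
      also have "\<dots> < h k * 1" using h(1)[of k] w(3)[of n] by (intro mult_strict_left_mono) auto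
      also have "\<dots> \<le> \<psi> (2 ^ Suc k)" using h(3) by simp
      also have "\<dots> \<le> \<psi> n"
      proof (rule monotone_onD[OF anti])
        show "n \<le> 2 ^ Suc k" using floor_log_exp2_ge[of n] by (simp add: k_def)
      qed (use n1 in auto)
      finally show "dist_nearest_int (real n * \<alpha>) * dist_nearest_int (real n * \<beta>) < \<psi> n" .
    qed
    ultimately show "\<beta> \<in> {\<beta>. infinite {n. n \<ge> 1 \<and> dist_nearest_int (real n * \<alpha>) * dist_nearest_int (real n * \<beta>) < \<psi> n}}"
      by (auto dest: infinite_super)
  qed
  ultimately show ?thesis using that by blast
qed

lemma borel_fibre:
  "{\<beta>. infinite {n. n \<ge> 1 \<and> dist_nearest_int (real n * \<alpha>) * dist_nearest_int (real n * \<beta>) < \<psi> n}} \<in> sets borel"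
proof -
  have "{\<beta>. infinite {n. n \<ge> 1 \<and> dist_nearest_int (real n * \<alpha>) * dist_nearest_int (real n * \<beta>) < \<psi> n}}
     = (\<Inter>m. \<Union>n\<in>{max m 1..}. {\<beta> \<in> space borel. dist_nearest_int (real n * \<alpha>) * dist_nearest_int (real n * \<beta>) < \<psi> n})"
    by (auto simp: infinite_nat_iff_unbounded_le Bex_def)
  also have "\<dots> \<in> sets borel"
  proof (intro sets.countable_INT sets.countable_UN'' image_subsetI)
    fix n
    show "{\<beta> \<in> space borel. dist_nearest_int (real n * \<alpha>) * dist_nearest_int (real n * \<beta>) < \<psi> n} \<in> sets borel"
      by measurable
  qed auto
  finally show ?thesis .
qed

text \<open>The sets \<open>E C\<close> for \<open>\<psi> / (C + 1)\<close> decrease in \<open>C\<close> and all have measure at least \<open>c\<^sub>0\<close>, hence so does their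
  intersection. Doubling maps \<open>E (2 C + 1)\<close> into \<open>E C\<close>, so the intersection is closed under
  doubling and the zero-one law applies.\<close>
lemma AE_fibre_of_equidistributed:
  fixes \<alpha> :: real and \<psi> :: "nat \<Rightarrow> real"
  assumes pos: "\<And>n. n \<ge> 1 \<Longrightarrow> \<psi> n > 0" and anti: "antimono_on {1..} \<psi>"
    and div: "\<not> summable (\<lambda>n. \<psi> (Suc n) * ln (real (Suc n)))"
    and equi: "eventually (equidistributed_scale \<alpha>) sequentially"
  shows "AE \<beta> in lebesgue. infinite {n. n \<ge> 1 \<and>
    dist_nearest_int (real n * \<alpha>) * dist_nearest_int (real n * \<beta>) < \<psi> n}"
proof -
  define S where "S C \<beta> = {n. n \<ge> 1 \<and> dist_nearest_int (real n * \<alpha>) * dist_nearest_int (real n * \<beta>) < \<psi> n / C}"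
    for C :: real and \<beta>
  define E where "E C = {\<beta>. infinite (S (real (Suc C)) \<beta>)}" for C
  define c0 :: real where "c0 = 2 * (exp (-98))\<^sup>2 / 5"
  have Eb: "E C \<in> sets borel" for C unfolding E_def S_def by (rule borel_fibre)
  have El: "E C \<inter> {0..1} \<in> lmeasurable" for C
    by (rule fmeasurableI2[of "{0..1}"]) (use Eb in auto)
  have ge: "measure lebesgue (E C \<inter> {0..1}) \<ge> c0" for C
  proof -
    obtain L where L: "L \<in> sets borel" "L \<subseteq> {0..1}" "measure lebesgue L \<ge> c0" "L \<subseteq> E C"
    proof (rule measure_fibre_ge[of "\<lambda>n. \<psi> n / real (Suc C)" \<alpha>])
      show "\<psi> n / real (Suc C) > 0" if "n \<ge> 1" for n using pos[OF that] by simp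
      show "antimono_on {1..} (\<lambda>n. \<psi> n / real (Suc C))"
        using anti by (auto simp: monotone_on_def intro: divide_right_mono)
      show "\<not> summable (\<lambda>n. \<psi> (Suc n) / real (Suc C) * ln (real (Suc n)))"
      proof
        assume "summable (\<lambda>n. \<psi> (Suc n) / real (Suc C) * ln (real (Suc n)))"
        hence "summable (\<lambda>n. real (Suc C) * (\<psi> (Suc n) / real (Suc C) * ln (real (Suc n))))" by (rule summable_mult)
        thus False using div by (simp del: of_nat_Suc)
      qed
    qed (auto simp: equi E_def S_def c0_def)
    have "measure lebesgue L \<le> measure lebesgue (E C \<inter> {0..1})"
      using L El by (intro measure_mono_fmeasurable) auto
    thus ?thesis using L(3) by simp
  qed
  have mono: "S C' \<beta> \<subseteq> S C \<beta>" if "0 < C" "C \<le> C'" for C C' \<beta>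
  proof
    fix n assume n: "n \<in> S C' \<beta>"
    hence "\<psi> n / C' \<le> \<psi> n / C" using that pos[of n] by (intro divide_left_mono) (auto simp: S_def)
    thus "n \<in> S C \<beta>" using n by (auto simp: S_def)
  qed
  define Einf where "Einf = (\<Inter>C. E C)"
  have "(\<lambda>C. measure lebesgue (E C \<inter> {0..1})) \<longlonglongrightarrow> measure lebesgue (\<Inter>C. E C \<inter> {0..1})"
  proof (rule Lim_measure_decseq)
    show "range (\<lambda>C. E C \<inter> {0..1}) \<subseteq> sets lebesgue" using El by auto
    have "E C' \<subseteq> E C" if "C \<le> C'" for C C'
      unfolding E_def using mono[of "real (Suc C)" "real (Suc C')"] that by (auto dest: infinite_super)
    thus "decseq (\<lambda>C. E C \<inter> {0..1})" by (auto simp: decseq_def)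
    show "emeasure lebesgue (E C \<inter> {0..1}) \<noteq> \<infinity>" for C using El[of C] by (auto simp: fmeasurable_def)
  qed
  hence "measure lebesgue (\<Inter>C. E C \<inter> {0..1}) \<ge> c0" by (rule LIMSEQ_le_const) (use ge in auto)
  also have "(\<Inter>C. E C \<inter> {0..1}) = Einf \<inter> {0..1}" by (auto simp: Einf_def)
  finally have "measure lebesgue (Einf \<inter> {0..1}) \<ge> c0" .
  moreover have "c0 > 0" by (simp add: c0_def)
  ultimately have "measure lebesgue (Einf \<inter> {0..1}) > 0" by linarith
  hence "AE \<beta> in lebesgue. \<beta> \<in> Einf"
  proof (rule doubling_zero_one_law[rotated])
    show "Einf \<in> sets borel" unfolding Einf_def using Eb by (intro sets.countable_INT) auto
    show "\<beta> + 1 \<in> Einf \<longleftrightarrow> \<beta> \<in> Einf" for \<beta> by (simp add: Einf_def E_def S_def dist_nearest_int_shift)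
    show "2 * \<beta> \<in> Einf" if "\<beta> \<in> Einf" for \<beta>
      unfolding Einf_def
    proof
      fix C
      have "S (real (Suc (2 * C + 1))) \<beta> \<subseteq> S (real (Suc C)) (2 * \<beta>)"
      proof
        fix n assume n: "n \<in> S (real (Suc (2 * C + 1))) \<beta>"
        have "dist_nearest_int (real n * \<alpha>) * dist_nearest_int (real n * (2 * \<beta>))
            \<le> dist_nearest_int (real n * \<alpha>) * (2 * dist_nearest_int (real n * \<beta>))"
          using dist_nearest_int_double dist_nearest_int_nonneg by (intro mult_left_mono) auto
        also have "\<dots> < 2 * (\<psi> n / real (Suc (2 * C + 1)))" using n by (auto simp: S_def)
        also have "\<dots> = \<psi> n / real (Suc C)" by (simp add: field_simps)
        finally show "n \<in> S (real (Suc C)) (2 * \<beta>)" using n by (auto simp: S_def)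
      qed
      moreover have "infinite (S (real (Suc (2 * C + 1))) \<beta>)"
        using that unfolding Einf_def E_def by blast
      ultimately show "2 * \<beta> \<in> E C" unfolding E_def by (auto dest: infinite_super)
    qed
  qed
  moreover have "infinite (S 1 \<beta>)" if "\<beta> \<in> Einf" for \<beta>
    using that by (auto simp: Einf_def E_def dest: spec[of _ 0])
  ultimately show ?thesis unfolding S_def by (auto elim!: eventually_mono)
qed

text \<open>Here \<open>\<beta>\<close> enters only through the trivial bound \<open>\<parallel>n \<beta>\<parallel> \<le> 1\<close>; distinct solutions arise because \<open>q\<^sub>l \<ge> l\<close>.\<close>
lemma infinite_of_infinitely_many_convergents:
  assumes irr: "\<alpha> \<notin> \<rat>"
    and pos: "\<And>n. n \<ge> 1 \<Longrightarrow> \<psi> n > 0"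
    and freq: "\<exists>\<^sub>\<infinity>l. dist_nearest_int (real (convergent_denom \<alpha> l) * \<alpha>) < \<psi> (convergent_denom \<alpha> l)"
  shows "infinite {n. n \<ge> 1 \<and> dist_nearest_int (real n * \<alpha>) * dist_nearest_int (real n * \<beta>) < \<psi> n}"
  unfolding infinite_nat_iff_unbounded_le
proof
  fix m
  obtain l where l: "l \<ge> m" "dist_nearest_int (real (convergent_denom \<alpha> l) * \<alpha>) < \<psi> (convergent_denom \<alpha> l)"
    using freq unfolding INFM_nat_le by blast
  define n where "n = convergent_denom \<alpha> l"
  have n: "n \<ge> m" "n \<ge> 1" using convergent_denom_ge[OF irr, of l] convergent_denom_conv(2)[OF irr, of l] l
    by (auto simp: n_def)
  have "dist_nearest_int (real n * \<alpha>) * dist_nearest_int (real n * \<beta>) \<le> dist_nearest_int (real n * \<alpha>) * 1"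
    using dist_nearest_int_le_half[of "real n * \<beta>"] dist_nearest_int_nonneg by (intro mult_left_mono) auto
  also have "\<dots> < \<psi> n" using l by (simp add: n_def)
  finally show "\<exists>n\<ge>m. n \<in> {n. n \<ge> 1 \<and> dist_nearest_int (real n * \<alpha>) * dist_nearest_int (real n * \<beta>) < \<psi> n}"
    using n by blast
qed

lemma infinite_fibre_of_rational:
  assumes "\<alpha> \<in> \<rat>" and pos: "\<And>n. n \<ge> 1 \<Longrightarrow> \<psi> n > 0"
  shows "infinite {n. n \<ge> 1 \<and> dist_nearest_int (real n * \<alpha>) * dist_nearest_int (real n * \<beta>) < \<psi> n}"
  unfolding infinite_nat_iff_unbounded_le
proof
  fix m :: nat
  obtain a :: int and b :: nat where b: "b > 0" "\<alpha> = of_int a / real b"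
    using assms(1) unfolding Rats_eq_int_div_nat by auto
  define n where "n = b * Suc m"
  have "real n * \<alpha> = of_int (int (Suc m) * a)" using b by (simp add: n_def field_simps)
  hence "dist_nearest_int (real n * \<alpha>) \<le> 0"
    using dist_nearest_int_le[of "real n * \<alpha>" "int (Suc m) * a"] by simp
  hence "dist_nearest_int (real n * \<alpha>) = 0" using dist_nearest_int_nonneg[of "real n * \<alpha>"] by simp
  moreover have "n \<ge> 1 * Suc m" unfolding n_def using b(1) by (intro mult_right_mono) auto
  ultimately show "\<exists>n\<ge>m. n \<in> {n. n \<ge> 1 \<and> dist_nearest_int (real n * \<alpha>) * dist_nearest_int (real n * \<beta>) < \<psi> n}"
    using pos[of n] by (intro exI[of _ n]) auto
qed

theorem theorem2p1:
  fixes \<alpha> :: real and \<psi> :: "nat \<Rightarrow> real"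
  assumes "\<And>n. n \<ge> 1 \<Longrightarrow> \<psi> n > 0"
    and "mono_on {1..} \<psi> \<or> antimono_on {1..} \<psi>"
    and "\<not> summable (\<lambda>n. \<psi> (Suc n) * ln (real (Suc n)))"
    and "\<alpha> \<notin> \<rat> \<Longrightarrow>
      \<exists>\<epsilon>>0. liminf (\<lambda>l. ereal (real (convergent_denom \<alpha> l) powr (3 - \<epsilon>)
                              * \<psi> (convergent_denom \<alpha> l))) \<ge> 1"
  shows "AE \<beta> in lebesgue. infinite {n. n \<ge> 1 \<and>
    dist_nearest_int (real n * \<alpha>) * dist_nearest_int (real n * \<beta>) < \<psi> n}"
proof (cases "\<alpha> \<in> \<rat>")
  case True
  show ?thesis by (intro AE_I2 infinite_fibre_of_rational[OF True assms(1)])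
next
  case irr: False
  define Q where "Q = convergent_denom \<alpha>"
  have Q: "Q l \<ge> l" "Q l \<ge> 1" for l
    using convergent_denom_ge[OF irr] convergent_denom_conv(2)[OF irr] by (auto simp: Q_def)
  have err: "dist_nearest_int (real (Q l) * \<alpha>) * real (Q (Suc l)) \<le> 1" for l
    using dist_nearest_int_convergent_denom[OF irr] by (simp add: Q_def)
  show ?thesis
  proof (cases "\<exists>\<^sub>\<infinity>l. dist_nearest_int (real (Q l) * \<alpha>) < \<psi> (Q l)")
    case True
    show ?thesis
      using infinite_of_infinitely_many_convergents[OF irr assms(1) True[unfolded Q_def]] by (intro AE_I2)
  next
    case False
    hence far: "eventually (\<lambda>l. \<psi> (Q l) \<le> dist_nearest_int (real (Q l) * \<alpha>)) sequentially"
      by (simp add: not_frequently not_less flip: cofinite_eq_sequentially)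
    \<comment> \<open>an increasing \<open>\<psi>\<close> stays above \<open>\<psi> 1\<close>, whereas \<open>\<parallel>q\<^sub>l \<alpha>\<parallel>\<close> tends to 0\<close>
    have "antimono_on {1..} \<psi>"
    proof (rule ccontr)
      assume "\<not> antimono_on {1..} \<psi>"
      hence mono: "mono_on {1..} \<psi>" using assms(2) by blast
      have "eventually (\<lambda>l. \<psi> 1 * real l \<le> 1) sequentially"
        using far
      proof eventually_elim
        case (elim l)
        have "\<psi> 1 \<le> dist_nearest_int (real (Q l) * \<alpha>)"
          using elim monotone_onD[OF mono, of 1 "Q l"] Q(2)[of l] by auto
        hence "\<psi> 1 * real l \<le> dist_nearest_int (real (Q l) * \<alpha>) * real (Q (Suc l))"
          using Q(1)[of "Suc l"] dist_nearest_int_nonneg by (intro mult_mono) auto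
        thus ?case using err[of l] by linarith
      qed
      moreover have "eventually (\<lambda>l. \<psi> 1 * real l > 1) sequentially"
        using assms(1)[of 1] by real_asymp
      ultimately have "eventually (\<lambda>l::nat. False) sequentially" by eventually_elim linarith
      thus False by simp
    qed
    \<comment> \<open>combine \<open>1 / (2 q\<^sub>l\<^sup>3) < \<psi> q\<^sub>l \<le> \<parallel>q\<^sub>l \<alpha>\<parallel> \<le> 1 / q\<^sub>l\<^sub>+\<^sub>1\<close>\<close>
    moreover have "eventually (\<lambda>l. Q (Suc l) \<le> 2 * Q l ^ 3) sequentially"
    proof -
      obtain \<epsilon> where \<epsilon>: "\<epsilon> > 0" "liminf (\<lambda>l. ereal (real (Q l) powr (3 - \<epsilon>) * \<psi> (Q l))) \<ge> 1"
        using assms(4)[OF irr] unfolding Q_def by blast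
      have "ereal (1 / 2) < 1" by simp
      also note \<epsilon>(2)
      finally have "eventually (\<lambda>l. ereal (1 / 2) < ereal (real (Q l) powr (3 - \<epsilon>) * \<psi> (Q l))) sequentially"
        by (rule less_LiminfD)
      thus ?thesis using far
      proof eventually_elim
        case (elim l)
        have \<psi>0: "\<psi> (Q l) > 0" using assms(1) Q(2) by blast
        have "real (Q l) powr (3 - \<epsilon>) \<le> real (Q l) powr 3" using Q(2)[of l] \<epsilon>(1) by (intro powr_mono) auto
        also have "\<dots> = real (Q l) ^ 3" using Q(2)[of l] by (subst powr_numeral) auto
        finally have "real (Q l) powr (3 - \<epsilon>) * \<psi> (Q l) \<le> real (Q l) ^ 3 * \<psi> (Q l)"
          using \<psi>0 by (intro mult_right_mono) auto
        hence low: "1 < 2 * real (Q l) ^ 3 * \<psi> (Q l)" using elim(1) by simp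
        have "\<psi> (Q l) * real (Q (Suc l)) \<le> dist_nearest_int (real (Q l) * \<alpha>) * real (Q (Suc l))"
          using elim(2) by (intro mult_right_mono) auto
        also have "\<dots> \<le> 1" by (rule err)
        finally have "\<psi> (Q l) * real (Q (Suc l)) < \<psi> (Q l) * (2 * real (Q l) ^ 3)" using low by (simp add: mult_ac)
        hence "real (Q (Suc l)) < 2 * real (Q l) ^ 3" using \<psi>0 by (simp only: mult_less_cancel_left_pos)
        also have "\<dots> = real (2 * Q l ^ 3)" by simp
        finally show ?case by (simp only: of_nat_less_iff)
      qed
    qed
    hence "eventually (equidistributed_scale \<alpha>) sequentially"
      unfolding Q_def by (rule eventually_equidistributed_scale[OF irr])
    ultimately show ?thesis using AE_fibre_of_equidistributed assms(1,3) by blast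
  qed
qed

end
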